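(* Let $\mathsf{J}$ be a $1$-category, let $W:\mathsf{J}\to\mathsf{Cat}$ be a weight and let $\mathsf{X}:\mathsf{J}\to\mathsf{CAT}$ be a diagram of categories. Suppose that the diagram $\mathsf{X}$ is fibrant in the injective-canonical model structure on $[\mathsf{J},\mathsf{CAT}]$ and that, for all $f:j\to k$ in $\mathsf{J}$: (i) the category $\mathsf{X}_k$ admits all $W_j$-colimits and all $W_k$-colimits; (ii) the functor $\mathsf{X}_f:\mathsf{X}_j\to\mathsf{X}_k$ preserves $W_j$-colimits; and (iii) the functor $W_f:W_j\to W_k$ is final. Then the functor $$\Delta:[\mathsf{J},\mathsf{CAT}](\bullet,\mathsf{X})\longrightarrow[\mathsf{J},\mathsf{CAT}](W,\mathsf{X})$$ admits a left adjoint.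
   Context: $[\mathsf{J},\mathsf{CAT}]$ is the $2$-category of functors $\mathsf{J}\to\mathsf{CAT}$, (strict) natural transformations and modifications; $[\mathsf{J},\mathsf{CAT}](W,\mathsf{X})$ is the category of natural transformations $W\Rightarrow\mathsf{X}$ and modifications between them (the $W$-weighted limit of $\mathsf{X}$). $\bullet$ denotes the constant weight at the terminal category, so $[\mathsf{J},\mathsf{CAT}](\bullet,\mathsf{X})$ is the conical limit of $\mathsf{X}$. The functor $\Delta$ is precomposition with the unique natural transformation $W\Rightarrow\bullet$. "$W_j$-colimits" in a category are colimits of diagrams indexed by the category $W_j$. The injective-canonical model structure on $[\mathsf{J},\mathsf{CAT}]$ is the injective model structure with respect to the canonical model structure on $\mathsf{CAT}$ (weak equivalences: equivalences of categories; fibrations: iso-fibrations; cofibrations: functors injective on objects): its weak equivalences and cofibrations are levelwise, and its fibrations are the maps with the right lifting property against the levelwise trivial cofibrations. *)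

theory Defs
  imports Main "HOL-Library.FuncSet" "HOL-Library.Equipollence"
begin

section \<open>Categories, functors, natural transformations\<close>

record ('o, 'm) cat =
  Obj :: "'o set"
  Arr :: "'m set"
  Dom :: "'m \<Rightarrow> 'o"
  Cod :: "'m \<Rightarrow> 'o"
  Ide :: "'o \<Rightarrow> 'm"
  Comp :: "'m \<Rightarrow> 'm \<Rightarrow> 'm"  \<comment> \<open>\<open>Comp C g f\<close> is \<open>g\<close> after \<open>f\<close>\<close>

definition hom :: "('o, 'm) cat \<Rightarrow> 'o \<Rightarrow> 'o \<Rightarrow> 'm set" where
  "hom C a b = {f \<in> Arr C. Dom C f = a \<and> Cod C f = b}"

locale category =
  fixes C :: "('o, 'm) cat"
  assumes Dom_in: "f \<in> Arr C \<Longrightarrow> Dom C f \<in> Obj C"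
    and Cod_in: "f \<in> Arr C \<Longrightarrow> Cod C f \<in> Obj C"
    and Ide_in: "a \<in> Obj C \<Longrightarrow> Ide C a \<in> hom C a a"
    and Comp_in: "\<lbrakk>f \<in> Arr C; g \<in> Arr C; Cod C f = Dom C g\<rbrakk>
                  \<Longrightarrow> Comp C g f \<in> hom C (Dom C f) (Cod C g)"
    and Comp_Ide: "f \<in> Arr C \<Longrightarrow> Comp C f (Ide C (Dom C f)) = f"
    and Ide_Comp: "f \<in> Arr C \<Longrightarrow> Comp C (Ide C (Cod C f)) f = f"
    and Comp_assoc: "\<lbrakk>f \<in> Arr C; g \<in> Arr C; h \<in> Arr C; Cod C f = Dom C g; Cod C g = Dom C h\<rbrakk>
                     \<Longrightarrow> Comp C h (Comp C g f) = Comp C (Comp C h g) f"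

definition iso_arr :: "('o, 'm) cat \<Rightarrow> 'm \<Rightarrow> bool" where
  "iso_arr C f \<longleftrightarrow> f \<in> Arr C \<and>
     (\<exists>g \<in> hom C (Cod C f) (Dom C f).
        Comp C g f = Ide C (Dom C f) \<and> Comp C f g = Ide C (Cod C f))"

record ('o, 'm, 'p, 'n) fctr =
  ob :: "'o \<Rightarrow> 'p"
  ar :: "'m \<Rightarrow> 'n"

text \<open>
  Functors, and likewise all families below, are required to be \<^const>\<open>undefined\<close> outside their
  domain (\<^const>\<open>extensional\<close>), so that HOL equality is the usual equality of functors,
  natural transformations and modifications.
\<close>

locale cat_functor = C: category C + D: category D
  for C :: "('o, 'm) cat" and D :: "('p, 'n) cat" +
  fixes F :: "('o, 'm, 'p, 'n) fctr"
  assumes ob_ext: "ob F \<in> extensional (Obj C)"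
    and ar_ext: "ar F \<in> extensional (Arr C)"
    and ob_in: "a \<in> Obj C \<Longrightarrow> ob F a \<in> Obj D"
    and ar_in: "f \<in> Arr C \<Longrightarrow> ar F f \<in> hom D (ob F (Dom C f)) (ob F (Cod C f))"
    and ar_Ide: "a \<in> Obj C \<Longrightarrow> ar F (Ide C a) = Ide D (ob F a)"
    and ar_Comp: "\<lbrakk>f \<in> Arr C; g \<in> Arr C; Cod C f = Dom C g\<rbrakk>
                  \<Longrightarrow> ar F (Comp C g f) = Comp D (ar F g) (ar F f)"

definition id_functor :: "('o, 'm) cat \<Rightarrow> ('o, 'm, 'o, 'm) fctr" where
  "id_functor C = \<lparr>ob = (\<lambda>a \<in> Obj C. a), ar = (\<lambda>f \<in> Arr C. f)\<rparr>"

definition comp_functor ::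
  "('o, 'm) cat \<Rightarrow> ('p, 'n, 'q, 'r) fctr \<Rightarrow> ('o, 'm, 'p, 'n) fctr \<Rightarrow> ('o, 'm, 'q, 'r) fctr" where
  "comp_functor C G F =
     \<lparr>ob = compose (Obj C) (ob G) (ob F), ar = compose (Arr C) (ar G) (ar F)\<rparr>"

definition const_functor :: "('o, 'm) cat \<Rightarrow> ('p, 'n) cat \<Rightarrow> 'p \<Rightarrow> ('o, 'm, 'p, 'n) fctr" where
  "const_functor C D d = \<lparr>ob = (\<lambda>a \<in> Obj C. d), ar = (\<lambda>f \<in> Arr C. Ide D d)\<rparr>"

definition nat_trans ::
  "('o, 'm) cat \<Rightarrow> ('p, 'n) cat \<Rightarrow> ('o, 'm, 'p, 'n) fctr \<Rightarrow> ('o, 'm, 'p, 'n) fctr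
   \<Rightarrow> ('o \<Rightarrow> 'n) \<Rightarrow> bool" where
  "nat_trans C D F G \<tau> \<longleftrightarrow>
     cat_functor C D F \<and> cat_functor C D G \<and> \<tau> \<in> extensional (Obj C) \<and>
     (\<forall>a \<in> Obj C. \<tau> a \<in> hom D (ob F a) (ob G a)) \<and>
     (\<forall>f \<in> Arr C. Comp D (ar G f) (\<tau> (Dom C f)) = Comp D (\<tau> (Cod C f)) (ar F f))"

definition nat_iso ::
  "('o, 'm) cat \<Rightarrow> ('p, 'n) cat \<Rightarrow> ('o, 'm, 'p, 'n) fctr \<Rightarrow> ('o, 'm, 'p, 'n) fctr
   \<Rightarrow> ('o \<Rightarrow> 'n) \<Rightarrow> bool" where
  "nat_iso C D F G \<tau> \<longleftrightarrow> nat_trans C D F G \<tau> \<and> (\<forall>a \<in> Obj C. iso_arr D (\<tau> a))"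

definition equivalence_functor ::
  "('o, 'm) cat \<Rightarrow> ('p, 'n) cat \<Rightarrow> ('o, 'm, 'p, 'n) fctr \<Rightarrow> bool" where
  "equivalence_functor C D F \<longleftrightarrow> cat_functor C D F \<and>
     (\<exists>G \<eta> \<epsilon>. cat_functor D C G \<and>
        nat_iso C C (id_functor C) (comp_functor C G F) \<eta> \<and>
        nat_iso D D (comp_functor D F G) (id_functor D) \<epsilon>)"

definition adjunction ::
  "('o, 'm) cat \<Rightarrow> ('p, 'n) cat \<Rightarrow> ('o, 'm, 'p, 'n) fctr \<Rightarrow> ('p, 'n, 'o, 'm) fctr
   \<Rightarrow> ('o \<Rightarrow> 'm) \<Rightarrow> ('p \<Rightarrow> 'n) \<Rightarrow> bool"
  \<comment> \<open>\<open>F\<close> is left adjoint to \<open>G\<close>, with unit \<open>\<eta>\<close> and counit \<open>\<epsilon>\<close>\<close> where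
  "adjunction C D F G \<eta> \<epsilon> \<longleftrightarrow>
     cat_functor C D F \<and> cat_functor D C G \<and>
     nat_trans C C (id_functor C) (comp_functor C G F) \<eta> \<and>
     nat_trans D D (comp_functor D F G) (id_functor D) \<epsilon> \<and>
     (\<forall>c \<in> Obj C. Comp D (\<epsilon> (ob F c)) (ar F (\<eta> c)) = Ide D (ob F c)) \<and>
     (\<forall>d \<in> Obj D. Comp C (ar G (\<epsilon> d)) (\<eta> (ob G d)) = Ide C (ob G d))"

definition admits_left_adjoint ::
  "('p, 'n) cat \<Rightarrow> ('o, 'm) cat \<Rightarrow> ('p, 'n, 'o, 'm) fctr \<Rightarrow> bool" where
  "admits_left_adjoint D C G \<longleftrightarrow> (\<exists>F \<eta> \<epsilon>. adjunction C D F G \<eta> \<epsilon>)"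


section \<open>Colimits and final functors\<close>

definition cocone ::
  "('o, 'm) cat \<Rightarrow> ('p, 'n) cat \<Rightarrow> ('o, 'm, 'p, 'n) fctr \<Rightarrow> 'p \<Rightarrow> ('o \<Rightarrow> 'n) \<Rightarrow> bool" where
  "cocone I C K c \<iota> \<longleftrightarrow> c \<in> Obj C \<and> nat_trans I C K (const_functor I C c) \<iota>"

definition is_colimit ::
  "('o, 'm) cat \<Rightarrow> ('p, 'n) cat \<Rightarrow> ('o, 'm, 'p, 'n) fctr \<Rightarrow> 'p \<Rightarrow> ('o \<Rightarrow> 'n) \<Rightarrow> bool" where
  "is_colimit I C K c \<iota> \<longleftrightarrow> cocone I C K c \<iota> \<and>
     (\<forall>c' \<iota>'. cocone I C K c' \<iota>' \<longrightarrow>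
        (\<exists>!h. h \<in> hom C c c' \<and> (\<forall>i \<in> Obj I. Comp C h (\<iota> i) = \<iota>' i)))"

definition admits_colimits :: "('o, 'm) cat \<Rightarrow> ('p, 'n) cat \<Rightarrow> bool" where
  "admits_colimits I C \<longleftrightarrow> (\<forall>K. cat_functor I C K \<longrightarrow> (\<exists>c \<iota>. is_colimit I C K c \<iota>))"

definition preserves_colimits ::
  "('o, 'm) cat \<Rightarrow> ('p, 'n) cat \<Rightarrow> ('q, 'r) cat \<Rightarrow> ('p, 'n, 'q, 'r) fctr \<Rightarrow> bool" where
  "preserves_colimits I C D F \<longleftrightarrow>
     (\<forall>K c \<iota>. cat_functor I C K \<and> is_colimit I C K c \<iota> \<longrightarrow>
        is_colimit I D (comp_functor I F K) (ob F c) (\<lambda>i \<in> Obj I. ar F (\<iota> i)))"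

definition comma_under ::
  "('o, 'm) cat \<Rightarrow> ('p, 'n) cat \<Rightarrow> ('o, 'm, 'p, 'n) fctr \<Rightarrow> 'p
   \<Rightarrow> ('o \<times> 'n, ('o \<times> 'n) \<times> 'm \<times> ('o \<times> 'n)) cat"
  \<comment> \<open>the comma category \<open>d \<down> F\<close>; arrows are tagged with their domain and codomain\<close> where
  "comma_under C D F d =
     \<lparr>Obj = {(c, u). c \<in> Obj C \<and> u \<in> hom D d (ob F c)},
      Arr = {((c, u), h, (c', u')). c \<in> Obj C \<and> u \<in> hom D d (ob F c) \<and>
               c' \<in> Obj C \<and> u' \<in> hom D d (ob F c') \<and>
               h \<in> hom C c c' \<and> Comp D (ar F h) u = u'},
      Dom = (\<lambda>(x, h, y). x),
      Cod = (\<lambda>(x, h, y). y),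
      Ide = (\<lambda>x. (x, Ide C (fst x), x)),
      Comp = (\<lambda>(y, k, z) (x, h, y'). (x, Comp C k h, z))\<rparr>"

definition connected_category :: "('o, 'm) cat \<Rightarrow> bool" where
  "connected_category C \<longleftrightarrow> Obj C \<noteq> {} \<and>
     (\<forall>a \<in> Obj C. \<forall>b \<in> Obj C. (a, b) \<in> {(x, y). hom C x y \<noteq> {} \<or> hom C y x \<noteq> {}}\<^sup>*)"

definition final_functor ::
  "('o, 'm) cat \<Rightarrow> ('p, 'n) cat \<Rightarrow> ('o, 'm, 'p, 'n) fctr \<Rightarrow> bool" where
  "final_functor C D F \<longleftrightarrow> cat_functor C D F \<and>
     (\<forall>d \<in> Obj D. connected_category (comma_under C D F d))"


section \<open>The 2-category of diagrams of categories\<close>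

text \<open>
  An infinite type \<^typ>\<open>'u\<close> plays the role of the class of all sets: the objects of \<open>CAT\<close> are the categories
  of type \<^typ>\<open>('u, 'u) cat\<close>, whose object and arrow classes are subclasses of \<^typ>\<open>'u\<close>, and \<open>Cat\<close>
  consists of those for which both classes are small, in the sense of limitation of size.
\<close>

definition small_category :: "('u, 'u) cat \<Rightarrow> bool" where
  "small_category C \<longleftrightarrow> Obj C \<prec> (UNIV :: 'u set) \<and> Arr C \<prec> (UNIV :: 'u set)"

record ('j, 'k, 'o, 'm) diag =
  at_ob :: "'j \<Rightarrow> ('o, 'm) cat"
  at_ar :: "'k \<Rightarrow> ('o, 'm, 'o, 'm) fctr"

locale diagram = J: category J
  for J :: "('j, 'k) cat" +
  fixes X :: "('j, 'k, 'o, 'm) diag"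
  assumes at_ob_category: "j \<in> Obj J \<Longrightarrow> category (at_ob X j)"
    and at_ar_functor: "f \<in> Arr J \<Longrightarrow>
          cat_functor (at_ob X (Dom J f)) (at_ob X (Cod J f)) (at_ar X f)"
    and at_ar_Ide: "j \<in> Obj J \<Longrightarrow> at_ar X (Ide J j) = id_functor (at_ob X j)"
    and at_ar_Comp: "\<lbrakk>f \<in> Arr J; g \<in> Arr J; Cod J f = Dom J g\<rbrakk> \<Longrightarrow>
          at_ar X (Comp J g f) = comp_functor (at_ob X (Dom J f)) (at_ar X g) (at_ar X f)"

definition diag_trans ::
  "('j, 'k) cat \<Rightarrow> ('j, 'k, 'o, 'm) diag \<Rightarrow> ('j, 'k, 'p, 'n) diag
   \<Rightarrow> ('j \<Rightarrow> ('o, 'm, 'p, 'n) fctr) \<Rightarrow> bool"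
  \<comment> \<open>strict natural transformations \<open>W \<Rightarrow> X\<close>\<close> where
  "diag_trans J W X \<alpha> \<longleftrightarrow>
     diagram J W \<and> diagram J X \<and> \<alpha> \<in> extensional (Obj J) \<and>
     (\<forall>j \<in> Obj J. cat_functor (at_ob W j) (at_ob X j) (\<alpha> j)) \<and>
     (\<forall>f \<in> Arr J. comp_functor (at_ob W (Dom J f)) (at_ar X f) (\<alpha> (Dom J f)) =
                  comp_functor (at_ob W (Dom J f)) (\<alpha> (Cod J f)) (at_ar W f))"

definition comp_trans ::
  "('j, 'k) cat \<Rightarrow> ('j, 'k, 'o, 'm) diag \<Rightarrow> ('j \<Rightarrow> ('p, 'n, 'q, 'r) fctr)
   \<Rightarrow> ('j \<Rightarrow> ('o, 'm, 'p, 'n) fctr) \<Rightarrow> ('j \<Rightarrow> ('o, 'm, 'q, 'r) fctr)"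
  \<comment> \<open>\<open>comp_trans J V \<beta> \<alpha>\<close> is \<open>\<beta>\<close> after \<open>\<alpha>\<close>, where \<open>V\<close> is the domain of \<open>\<alpha>\<close>\<close> where
  "comp_trans J V \<beta> \<alpha> = (\<lambda>j \<in> Obj J. comp_functor (at_ob V j) (\<beta> j) (\<alpha> j))"

definition modification ::
  "('j, 'k) cat \<Rightarrow> ('j, 'k, 'o, 'm) diag \<Rightarrow> ('j, 'k, 'p, 'n) diag
   \<Rightarrow> ('j \<Rightarrow> ('o, 'm, 'p, 'n) fctr) \<Rightarrow> ('j \<Rightarrow> ('o, 'm, 'p, 'n) fctr)
   \<Rightarrow> ('j \<Rightarrow> 'o \<Rightarrow> 'n) \<Rightarrow> bool" where
  "modification J W X \<alpha> \<beta> \<mu> \<longleftrightarrow>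
     diag_trans J W X \<alpha> \<and> diag_trans J W X \<beta> \<and> \<mu> \<in> extensional (Obj J) \<and>
     (\<forall>j \<in> Obj J. nat_trans (at_ob W j) (at_ob X j) (\<alpha> j) (\<beta> j) (\<mu> j)) \<and>
     (\<forall>f \<in> Arr J. \<forall>w \<in> Obj (at_ob W (Dom J f)).
        ar (at_ar X f) (\<mu> (Dom J f) w) = \<mu> (Cod J f) (ob (at_ar W f) w))"

text \<open>The hom-category \<open>[J, CAT](W, X)\<close>; arrows are tagged with their domain and codomain.\<close>

definition diag_hom ::
  "('j, 'k) cat \<Rightarrow> ('j, 'k, 'o, 'm) diag \<Rightarrow> ('j, 'k, 'p, 'n) diag
   \<Rightarrow> ('j \<Rightarrow> ('o, 'm, 'p, 'n) fctr,
       ('j \<Rightarrow> ('o, 'm, 'p, 'n) fctr) \<times> ('j \<Rightarrow> 'o \<Rightarrow> 'n) \<times> ('j \<Rightarrow> ('o, 'm, 'p, 'n) fctr)) cat" where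
  "diag_hom J W X =
     \<lparr>Obj = {\<alpha>. diag_trans J W X \<alpha>},
      Arr = {(\<alpha>, \<mu>, \<beta>). modification J W X \<alpha> \<beta> \<mu>},
      Dom = (\<lambda>(\<alpha>, \<mu>, \<beta>). \<alpha>),
      Cod = (\<lambda>(\<alpha>, \<mu>, \<beta>). \<beta>),
      Ide = (\<lambda>\<alpha>. (\<alpha>, (\<lambda>j \<in> Obj J. \<lambda>w \<in> Obj (at_ob W j). Ide (at_ob X j) (ob (\<alpha> j) w)), \<alpha>)),
      Comp = (\<lambda>(\<beta>, \<nu>, \<gamma>) (\<alpha>, \<mu>, \<beta>').
        (\<alpha>, (\<lambda>j \<in> Obj J. \<lambda>w \<in> Obj (at_ob W j). Comp (at_ob X j) (\<nu> j w) (\<mu> j w)), \<gamma>))\<rparr>"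

definition precomp_functor ::
  "('j, 'k) cat \<Rightarrow> ('j, 'k, 'o, 'm) diag \<Rightarrow> ('j, 'k, 'p, 'n) diag \<Rightarrow> ('j, 'k, 'q, 'r) diag
   \<Rightarrow> ('j \<Rightarrow> ('o, 'm, 'p, 'n) fctr)
   \<Rightarrow> ('j \<Rightarrow> ('p, 'n, 'q, 'r) fctr,
       ('j \<Rightarrow> ('p, 'n, 'q, 'r) fctr) \<times> ('j \<Rightarrow> 'p \<Rightarrow> 'r) \<times> ('j \<Rightarrow> ('p, 'n, 'q, 'r) fctr),
       'j \<Rightarrow> ('o, 'm, 'q, 'r) fctr,
       ('j \<Rightarrow> ('o, 'm, 'q, 'r) fctr) \<times> ('j \<Rightarrow> 'o \<Rightarrow> 'r) \<times> ('j \<Rightarrow> ('o, 'm, 'q, 'r) fctr)) fctr"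
  \<comment> \<open>for \<open>\<phi> : V \<Rightarrow> W\<close>, the functor \<open>[J, CAT](W, X) \<rightarrow> [J, CAT](V, X)\<close>\<close> where
  "precomp_functor J V W X \<phi> =
     \<lparr>ob = (\<lambda>\<alpha> \<in> Obj (diag_hom J W X). comp_trans J V \<alpha> \<phi>),
      ar = (\<lambda>(\<alpha>, \<mu>, \<beta>) \<in> Arr (diag_hom J W X).
              (comp_trans J V \<alpha> \<phi>,
               (\<lambda>j \<in> Obj J. \<lambda>v \<in> Obj (at_ob V j). \<mu> j (ob (\<phi> j) v)),
               comp_trans J V \<beta> \<phi>))\<rparr>"

definition terminal_category :: "('o, 'm) cat" where
  "terminal_category =
     \<lparr>Obj = {undefined}, Arr = {undefined}, Dom = (\<lambda>_. undefined), Cod = (\<lambda>_. undefined),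
      Ide = (\<lambda>_. undefined), Comp = (\<lambda>_ _. undefined)\<rparr>"

definition terminal_diag :: "('j, 'k, 'o, 'm) diag" where
  "terminal_diag = \<lparr>at_ob = (\<lambda>_. terminal_category), at_ar = (\<lambda>_. id_functor terminal_category)\<rparr>"

definition to_terminal ::
  "('j, 'k) cat \<Rightarrow> ('j, 'k, 'o, 'm) diag \<Rightarrow> ('j \<Rightarrow> ('o, 'm, 'p, 'n) fctr)" where
  "to_terminal J W =
     (\<lambda>j \<in> Obj J. const_functor (at_ob W j) (terminal_category :: ('p, 'n) cat) undefined)"

definition Delta ::
  "('j, 'k) cat \<Rightarrow> ('j, 'k, 'o, 'm) diag \<Rightarrow> ('j, 'k, 'p, 'n) diag
   \<Rightarrow> ('j \<Rightarrow> ('o, 'm, 'p, 'n) fctr,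
       ('j \<Rightarrow> ('o, 'm, 'p, 'n) fctr) \<times> ('j \<Rightarrow> 'o \<Rightarrow> 'n) \<times> ('j \<Rightarrow> ('o, 'm, 'p, 'n) fctr),
       'j \<Rightarrow> ('o, 'm, 'p, 'n) fctr,
       ('j \<Rightarrow> ('o, 'm, 'p, 'n) fctr) \<times> ('j \<Rightarrow> 'o \<Rightarrow> 'n) \<times> ('j \<Rightarrow> ('o, 'm, 'p, 'n) fctr)) fctr" where
  "Delta J W X = precomp_functor J W terminal_diag X (to_terminal J W)"


section \<open>Fibrations in the injective-canonical model structure\<close>

definition injective_weak_equivalence ::
  "('j, 'k) cat \<Rightarrow> ('j, 'k, 'o, 'm) diag \<Rightarrow> ('j, 'k, 'p, 'n) diag
   \<Rightarrow> ('j \<Rightarrow> ('o, 'm, 'p, 'n) fctr) \<Rightarrow> bool" where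
  "injective_weak_equivalence J A B i \<longleftrightarrow> diag_trans J A B i \<and>
     (\<forall>j \<in> Obj J. equivalence_functor (at_ob A j) (at_ob B j) (i j))"

definition injective_cofibration ::
  "('j, 'k) cat \<Rightarrow> ('j, 'k, 'o, 'm) diag \<Rightarrow> ('j, 'k, 'p, 'n) diag
   \<Rightarrow> ('j \<Rightarrow> ('o, 'm, 'p, 'n) fctr) \<Rightarrow> bool" where
  "injective_cofibration J A B i \<longleftrightarrow> diag_trans J A B i \<and>
     (\<forall>j \<in> Obj J. inj_on (ob (i j)) (Obj (at_ob A j)))"

text \<open>
  The test diagrams \<open>A\<close> and \<open>B\<close> range over the same universe of categories as \<open>X\<close> and \<open>Y\<close>.
\<close>

definition injective_fibration ::
  "('j, 'k) cat \<Rightarrow> ('j, 'k, 'u, 'u) diag \<Rightarrow> ('j, 'k, 'u, 'u) diag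
   \<Rightarrow> ('j \<Rightarrow> ('u, 'u, 'u, 'u) fctr) \<Rightarrow> bool" where
  "injective_fibration J X Y p \<longleftrightarrow> diag_trans J X Y p \<and>
     (\<forall>(A :: ('j, 'k, 'u, 'u) diag) (B :: ('j, 'k, 'u, 'u) diag) i u v.
        injective_weak_equivalence J A B i \<and> injective_cofibration J A B i \<and>
        diag_trans J A X u \<and> diag_trans J B Y v \<and>
        comp_trans J A p u = comp_trans J A v i \<longrightarrow>
        (\<exists>h. diag_trans J B X h \<and> comp_trans J A h i = u \<and> comp_trans J B p h = v))"

definition injective_fibrant :: "('j, 'k) cat \<Rightarrow> ('j, 'k, 'u, 'u) diag \<Rightarrow> bool" where
  "injective_fibrant J X \<longleftrightarrow> injective_fibration J X terminal_diag (to_terminal J X)"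


section \<open>Well-formedness\<close>

lemma comp_functor_simps [simp]:
  "a \<in> Obj C \<Longrightarrow> ob (comp_functor C G F) a = ob G (ob F a)"
  "f \<in> Arr C \<Longrightarrow> ar (comp_functor C G F) f = ar G (ar F f)"
  by (simp_all add: comp_functor_def compose_def)

lemma cat_functor_comp:
  assumes "cat_functor C D F" "cat_functor D E G"
  shows "cat_functor C E (comp_functor C G F)"
proof -
  interpret F: cat_functor C D F by fact
  interpret G: cat_functor D E G by fact
  have 1: "ar F f \<in> Arr D" "Dom D (ar F f) = ob F (Dom C f)" "Cod D (ar F f) = ob F (Cod C f)"
    if "f \<in> Arr C" for f using F.ar_in[OF that] by (auto simp: hom_def)
  have 2: "ar G f \<in> hom E (ob G (Dom D f)) (ob G (Cod D f))" if "f \<in> Arr D" for f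
    by (rule G.ar_in[OF that])
  show ?thesis
  proof
    show "ob (comp_functor C G F) \<in> extensional (Obj C)"
      "ar (comp_functor C G F) \<in> extensional (Arr C)"
      by (simp_all add: comp_functor_def)
  next
    fix a assume a: "a \<in> Obj C"
    then have "Ide C a \<in> Arr C" using F.C.Ide_in by (auto simp: hom_def)
    with a show "ar (comp_functor C G F) (Ide C a) = Ide E (ob (comp_functor C G F) a)"
      by (simp add: F.ar_Ide G.ar_Ide F.ob_in)
    show "ob (comp_functor C G F) a \<in> Obj E" using a by (simp add: F.ob_in G.ob_in)
  next
    fix f assume f: "f \<in> Arr C"
    show "ar (comp_functor C G F) f
            \<in> hom E (ob (comp_functor C G F) (Dom C f)) (ob (comp_functor C G F) (Cod C f))"
      using f 2[OF 1(1)[OF f]] by (simp add: 1 F.C.Dom_in F.C.Cod_in)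
  next
    fix f g assume fg: "f \<in> Arr C" "g \<in> Arr C" "Cod C f = Dom C g"
    then have "Comp C g f \<in> Arr C" using F.C.Comp_in by (auto simp: hom_def)
    with fg show "ar (comp_functor C G F) (Comp C g f)
        = Comp E (ar (comp_functor C G F) g) (ar (comp_functor C G F) f)"
      by (simp add: F.ar_Comp G.ar_Comp 1)
  qed
qed

lemma fctr_eqI:
  assumes "cat_functor C D F" "cat_functor C D G"
    and "\<And>a. a \<in> Obj C \<Longrightarrow> ob F a = ob G a" "\<And>f. f \<in> Arr C \<Longrightarrow> ar F f = ar G f"
  shows "F = G"
proof -
  interpret F: cat_functor C D F by fact
  interpret G: cat_functor C D G by fact
  have "ob F = ob G" using F.ob_ext G.ob_ext assms(3) by (rule extensionalityI)
  moreover have "ar F = ar G" using F.ar_ext G.ar_ext assms(4) by (rule extensionalityI)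
  ultimately show ?thesis by simp
qed

lemma comp_functor_assoc:
  assumes "cat_functor C D F"
  shows "comp_functor C (comp_functor D H G) F = comp_functor C H (comp_functor C G F)"
proof -
  interpret F: cat_functor C D F by fact
  have "\<And>f. f \<in> Arr C \<Longrightarrow> ar F f \<in> Arr D" using F.ar_in by (auto simp: hom_def)
  then show ?thesis
    by (auto simp: comp_functor_def compose_def fun_eq_iff F.ob_in)
qed

lemma category_terminal: "category (terminal_category :: ('o, 'm) cat)"
  by unfold_locales (auto simp: terminal_category_def hom_def)

lemma cat_functor_id: "category C \<Longrightarrow> cat_functor C C (id_functor C)"
  unfolding cat_functor_def cat_functor_axioms_def category_def
  by (auto simp: id_functor_def hom_def)

lemma diagram_terminal: "category J \<Longrightarrow> diagram J terminal_diag"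
  by (simp add: diagram_def diagram_axioms_def terminal_diag_def category_terminal cat_functor_id)
    (simp add: comp_functor_def id_functor_def compose_def fun_eq_iff)

lemma cat_functor_to_terminal:
  "category C \<Longrightarrow> cat_functor C terminal_category (const_functor C terminal_category undefined)"
  unfolding cat_functor_def cat_functor_axioms_def
  by (simp add: category_terminal)
    (auto simp: const_functor_def terminal_category_def hom_def category_def)

lemma cat_functor_terminal_unique:
  assumes "cat_functor C (terminal_category :: ('p, 'n) cat) F"
    "cat_functor C (terminal_category :: ('p, 'n) cat) G"
  shows "F = G"
proof -
  interpret F: cat_functor C "terminal_category :: ('p, 'n) cat" F by fact
  interpret G: cat_functor C "terminal_category :: ('p, 'n) cat" G by fact
  show ?thesis
    by (rule fctr_eqI[OF assms])
      (use F.ob_in G.ob_in F.ar_in G.ar_in in \<open>auto simp: terminal_category_def hom_def\<close>)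
qed

lemma diag_trans_to_terminal:
  fixes J :: "('j, 'k) cat" and W :: "('j, 'k, 'o, 'm) diag"
  assumes "diagram J W"
  shows "diag_trans J W (terminal_diag :: ('j, 'k, 'p, 'n) diag) (to_terminal J W)"
proof -
  interpret W: diagram J W by fact
  have 1: "cat_functor (at_ob W j) (terminal_category :: ('p, 'n) cat) (to_terminal J W j)"
    if "j \<in> Obj J" for j
    using cat_functor_to_terminal[OF W.at_ob_category[OF that]] that by (simp add: to_terminal_def)
  show ?thesis
    unfolding diag_trans_def
  proof (intro conjI ballI)
    show "diagram J terminal_diag" by (rule diagram_terminal) (rule W.J.category_axioms)
    show "to_terminal J W \<in> extensional (Obj J)" by (simp add: to_terminal_def)
  next
    fix f assume f: "f \<in> Arr J"
    show "comp_functor (at_ob W (Dom J f)) (at_ar terminal_diag f)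
            (to_terminal J W (Dom J f) :: (_, _, 'p, 'n) fctr) =
          comp_functor (at_ob W (Dom J f)) (to_terminal J W (Cod J f)) (at_ar W f)"
      by (rule cat_functor_terminal_unique; rule cat_functor_comp)
        (use f in \<open>auto simp: terminal_diag_def 1 W.J.Dom_in W.J.Cod_in category_terminal
            intro: cat_functor_id W.at_ar_functor\<close>)
  qed (use assms 1 in \<open>auto simp: terminal_diag_def\<close>)
qed

lemma to_terminal_unique:
  assumes "diag_trans J W terminal_diag \<phi>"
  shows "\<phi> = to_terminal J W"
proof (rule extensionalityI)
  have "diagram J W" using assms by (simp add: diag_trans_def)
  note t = diag_trans_to_terminal[OF this]
  show "\<phi> \<in> extensional (Obj J)" "to_terminal J W \<in> extensional (Obj J)"
    using assms by (auto simp: diag_trans_def to_terminal_def)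
  show "\<phi> j = to_terminal J W j" if "j \<in> Obj J" for j
    using assms t that unfolding diag_trans_def
    by (intro cat_functor_terminal_unique) (auto simp: terminal_diag_def)
qed

lemma diag_trans_comp:
  assumes "diag_trans J V W \<phi>" "diag_trans J W X \<alpha>"
  shows "diag_trans J V X (comp_trans J V \<alpha> \<phi>)"
proof -
  interpret V: diagram J V using assms by (simp add: diag_trans_def)
  interpret W: diagram J W using assms by (simp add: diag_trans_def)
  interpret X: diagram J X using assms by (simp add: diag_trans_def)
  have fn: "cat_functor (at_ob V j) (at_ob W j) (\<phi> j)" "cat_functor (at_ob W j) (at_ob X j) (\<alpha> j)"
    if "j \<in> Obj J" for j using assms that by (auto simp: diag_trans_def)
  show ?thesis
    unfolding diag_trans_def
  proof (intro conjI ballI)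
    fix f assume f: "f \<in> Arr J"
    let ?j = "Dom J f" and ?k = "Cod J f"
    have jk: "?j \<in> Obj J" "?k \<in> Obj J" using f V.J.Dom_in V.J.Cod_in by auto
    have "comp_functor (at_ob V ?j) (at_ar X f) (comp_functor (at_ob V ?j) (\<alpha> ?j) (\<phi> ?j)) =
          comp_functor (at_ob V ?j) (comp_functor (at_ob W ?j) (at_ar X f) (\<alpha> ?j)) (\<phi> ?j)"
      by (simp add: comp_functor_assoc[OF fn(1)[OF jk(1)]])
    also have "\<dots> = comp_functor (at_ob V ?j) (comp_functor (at_ob W ?j) (\<alpha> ?k) (at_ar W f)) (\<phi> ?j)"
      using assms f by (simp add: diag_trans_def)
    also have "\<dots> = comp_functor (at_ob V ?j) (\<alpha> ?k) (comp_functor (at_ob V ?j) (at_ar W f) (\<phi> ?j))"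
      by (simp add: comp_functor_assoc[OF fn(1)[OF jk(1)]])
    also have "\<dots> = comp_functor (at_ob V ?j) (\<alpha> ?k) (comp_functor (at_ob V ?j) (\<phi> ?k) (at_ar V f))"
      using assms f by (simp add: diag_trans_def)
    also have "\<dots> = comp_functor (at_ob V ?j) (comp_functor (at_ob V ?k) (\<alpha> ?k) (\<phi> ?k)) (at_ar V f)"
      by (simp add: comp_functor_assoc[OF V.at_ar_functor[OF f]])
    finally show "comp_functor (at_ob V ?j) (at_ar X f) (comp_trans J V \<alpha> \<phi> ?j) =
        comp_functor (at_ob V ?j) (comp_trans J V \<alpha> \<phi> ?k) (at_ar V f)"
      using jk by (simp add: comp_trans_def)
  qed (use assms in \<open>auto simp: diag_trans_def comp_trans_def intro: cat_functor_comp\<close>)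
qed

lemma category_diag_hom:
  assumes "diagram J W" "diagram J X"
  shows "category (diag_hom J W X)"
proof -
  interpret W: diagram J W by fact
  interpret X: diagram J X by fact
  have dc: "Dom J f \<in> Obj J" "Cod J f \<in> Obj J" if "f \<in> Arr J" for f
    using that W.J.Dom_in W.J.Cod_in by auto
  have Wob: "ob (at_ar W f) w \<in> Obj (at_ob W (Cod J f))"
    if "f \<in> Arr J" "w \<in> Obj (at_ob W (Dom J f))" for f w
    using cat_functor.ob_in[OF W.at_ar_functor] that by blast
  have id: "modification J W X \<alpha> \<alpha>
      (\<lambda>j \<in> Obj J. \<lambda>w \<in> Obj (at_ob W j). Ide (at_ob X j) (ob (\<alpha> j) w))"
    if a: "diag_trans J W X \<alpha>" for \<alpha>
    unfolding modification_def
  proof (intro conjI ballI)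
    fix j assume j: "j \<in> Obj J"
    interpret a: cat_functor "at_ob W j" "at_ob X j" "\<alpha> j" using a j by (simp add: diag_trans_def)
    show "nat_trans (at_ob W j) (at_ob X j) (\<alpha> j) (\<alpha> j)
        ((\<lambda>j \<in> Obj J. \<lambda>w \<in> Obj (at_ob W j). Ide (at_ob X j) (ob (\<alpha> j) w)) j)"
      unfolding nat_trans_def
    proof (intro conjI ballI)
      fix h assume h: "h \<in> Arr (at_ob W j)"
      have "ar (\<alpha> j) h \<in> Arr (at_ob X j)"
        "Dom (at_ob X j) (ar (\<alpha> j) h) = ob (\<alpha> j) (Dom (at_ob W j) h)"
        "Cod (at_ob X j) (ar (\<alpha> j) h) = ob (\<alpha> j) (Cod (at_ob W j) h)"
        using a.ar_in[OF h] by (auto simp: hom_def)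
      with a.D.Comp_Ide[of "ar (\<alpha> j) h"] a.D.Ide_Comp[of "ar (\<alpha> j) h"] h j
      show "Comp (at_ob X j) (ar (\<alpha> j) h)
           ((\<lambda>j \<in> Obj J. \<lambda>w \<in> Obj (at_ob W j). Ide (at_ob X j) (ob (\<alpha> j) w)) j (Dom (at_ob W j) h)) =
         Comp (at_ob X j)
           ((\<lambda>j \<in> Obj J. \<lambda>w \<in> Obj (at_ob W j). Ide (at_ob X j) (ob (\<alpha> j) w)) j (Cod (at_ob W j) h))
           (ar (\<alpha> j) h)"
        by (simp add: a.C.Dom_in a.C.Cod_in)
    qed (use j a.cat_functor_axioms in \<open>simp_all add: a.ob_in a.D.Ide_in\<close>)
  next
    fix f w assume f: "f \<in> Arr J" and w: "w \<in> Obj (at_ob W (Dom J f))"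
    interpret a: cat_functor "at_ob W (Dom J f)" "at_ob X (Dom J f)" "\<alpha> (Dom J f)"
      using a dc f by (simp add: diag_trans_def)
    interpret Xf: cat_functor "at_ob X (Dom J f)" "at_ob X (Cod J f)" "at_ar X f"
      using X.at_ar_functor f .
    have "ob (comp_functor (at_ob W (Dom J f)) (at_ar X f) (\<alpha> (Dom J f))) w =
          ob (comp_functor (at_ob W (Dom J f)) (\<alpha> (Cod J f)) (at_ar W f)) w"
      using a f by (simp add: diag_trans_def)
    then show "ar (at_ar X f) ((\<lambda>j \<in> Obj J. \<lambda>w \<in> Obj (at_ob W j). Ide (at_ob X j) (ob (\<alpha> j) w))
         (Dom J f) w) =
       (\<lambda>j \<in> Obj J. \<lambda>w \<in> Obj (at_ob W j). Ide (at_ob X j) (ob (\<alpha> j) w)) (Cod J f) (ob (at_ar W f) w)"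
      using w dc[OF f] Wob[OF f w] by (simp add: Xf.ar_Ide a.ob_in)
  qed (use a in auto)
  have comp: "modification J W X \<alpha> \<gamma>
      (\<lambda>j \<in> Obj J. \<lambda>w \<in> Obj (at_ob W j). Comp (at_ob X j) (\<nu> j w) (\<mu> j w))"
    if m: "modification J W X \<alpha> \<beta> \<mu>" and n: "modification J W X \<beta> \<gamma> \<nu>" for \<alpha> \<beta> \<gamma> \<mu> \<nu>
    unfolding modification_def
  proof (intro conjI ballI)
    fix j assume j: "j \<in> Obj J"
    have mj: "nat_trans (at_ob W j) (at_ob X j) (\<alpha> j) (\<beta> j) (\<mu> j)"
      and nj: "nat_trans (at_ob W j) (at_ob X j) (\<beta> j) (\<gamma> j) (\<nu> j)"
      using m n j by (auto simp: modification_def)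
    interpret a: cat_functor "at_ob W j" "at_ob X j" "\<alpha> j" using mj by (simp add: nat_trans_def)
    interpret b: cat_functor "at_ob W j" "at_ob X j" "\<beta> j" using mj by (simp add: nat_trans_def)
    interpret c: cat_functor "at_ob W j" "at_ob X j" "\<gamma> j" using nj by (simp add: nat_trans_def)
    have m1: "\<mu> j w \<in> Arr (at_ob X j)" "Dom (at_ob X j) (\<mu> j w) = ob (\<alpha> j) w"
       "Cod (at_ob X j) (\<mu> j w) = ob (\<beta> j) w" if "w \<in> Obj (at_ob W j)" for w
      using mj that by (auto simp: nat_trans_def hom_def)
    have n1: "\<nu> j w \<in> Arr (at_ob X j)" "Dom (at_ob X j) (\<nu> j w) = ob (\<beta> j) w"
       "Cod (at_ob X j) (\<nu> j w) = ob (\<gamma> j) w" if "w \<in> Obj (at_ob W j)" for w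
      using nj that by (auto simp: nat_trans_def hom_def)
    have cl: "Comp (at_ob X j) (\<nu> j w) (\<mu> j w) \<in> hom (at_ob X j) (ob (\<alpha> j) w) (ob (\<gamma> j) w)"
      if "w \<in> Obj (at_ob W j)" for w
      using a.D.Comp_in[OF m1(1)[OF that] n1(1)[OF that]] that by (simp add: m1 n1)
    have nat: "Comp (at_ob X j) (ar (\<gamma> j) h)
           (Comp (at_ob X j) (\<nu> j (Dom (at_ob W j) h)) (\<mu> j (Dom (at_ob W j) h))) =
         Comp (at_ob X j) (Comp (at_ob X j) (\<nu> j (Cod (at_ob W j) h)) (\<mu> j (Cod (at_ob W j) h)))
           (ar (\<alpha> j) h)" (is "?L = ?R") if h: "h \<in> Arr (at_ob W j)" for h
    proof -
      note [simp] = a.C.Dom_in[OF h] a.C.Cod_in[OF h]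
      have [simp]: "ar (\<alpha> j) h \<in> Arr (at_ob X j)" "ar (\<beta> j) h \<in> Arr (at_ob X j)"
        "ar (\<gamma> j) h \<in> Arr (at_ob X j)"
        "Dom (at_ob X j) (ar (\<alpha> j) h) = ob (\<alpha> j) (Dom (at_ob W j) h)"
        "Dom (at_ob X j) (ar (\<beta> j) h) = ob (\<beta> j) (Dom (at_ob W j) h)"
        "Dom (at_ob X j) (ar (\<gamma> j) h) = ob (\<gamma> j) (Dom (at_ob W j) h)"
        "Cod (at_ob X j) (ar (\<alpha> j) h) = ob (\<alpha> j) (Cod (at_ob W j) h)"
        "Cod (at_ob X j) (ar (\<beta> j) h) = ob (\<beta> j) (Cod (at_ob W j) h)"
        "Cod (at_ob X j) (ar (\<gamma> j) h) = ob (\<gamma> j) (Cod (at_ob W j) h)"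
        using a.ar_in[OF h] b.ar_in[OF h] c.ar_in[OF h] by (auto simp: hom_def)
      have "?L = Comp (at_ob X j) (Comp (at_ob X j) (ar (\<gamma> j) h) (\<nu> j (Dom (at_ob W j) h)))
               (\<mu> j (Dom (at_ob W j) h))"
        by (rule a.D.Comp_assoc) (simp_all add: m1 n1)
      also have "Comp (at_ob X j) (ar (\<gamma> j) h) (\<nu> j (Dom (at_ob W j) h)) =
           Comp (at_ob X j) (\<nu> j (Cod (at_ob W j) h)) (ar (\<beta> j) h)"
        using nj h by (simp add: nat_trans_def)
      also have "Comp (at_ob X j) \<dots> (\<mu> j (Dom (at_ob W j) h)) =
          Comp (at_ob X j) (\<nu> j (Cod (at_ob W j) h))
            (Comp (at_ob X j) (ar (\<beta> j) h) (\<mu> j (Dom (at_ob W j) h)))"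
        by (rule a.D.Comp_assoc[symmetric]) (simp_all add: m1 n1)
      also have "Comp (at_ob X j) (ar (\<beta> j) h) (\<mu> j (Dom (at_ob W j) h)) =
           Comp (at_ob X j) (\<mu> j (Cod (at_ob W j) h)) (ar (\<alpha> j) h)"
        using mj h by (simp add: nat_trans_def)
      also have "Comp (at_ob X j) (\<nu> j (Cod (at_ob W j) h)) \<dots> = ?R"
        by (rule a.D.Comp_assoc) (simp_all add: m1 n1)
      finally show ?thesis .
    qed
    show "nat_trans (at_ob W j) (at_ob X j) (\<alpha> j) (\<gamma> j)
        ((\<lambda>j \<in> Obj J. \<lambda>w \<in> Obj (at_ob W j). Comp (at_ob X j) (\<nu> j w) (\<mu> j w)) j)"
      unfolding nat_trans_def using j a.cat_functor_axioms c.cat_functor_axioms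
      by (simp add: cl nat a.C.Dom_in a.C.Cod_in)
  next
    fix f w assume f: "f \<in> Arr J" and w: "w \<in> Obj (at_ob W (Dom J f))"
    interpret Xf: cat_functor "at_ob X (Dom J f)" "at_ob X (Cod J f)" "at_ar X f"
      using X.at_ar_functor f .
    have "\<mu> (Dom J f) w \<in> hom (at_ob X (Dom J f)) (ob (\<alpha> (Dom J f)) w) (ob (\<beta> (Dom J f)) w)"
      "\<nu> (Dom J f) w \<in> hom (at_ob X (Dom J f)) (ob (\<beta> (Dom J f)) w) (ob (\<gamma> (Dom J f)) w)"
      using m n w dc[OF f] by (auto simp: modification_def nat_trans_def)
    then show "ar (at_ar X f)
        ((\<lambda>j \<in> Obj J. \<lambda>w \<in> Obj (at_ob W j). Comp (at_ob X j) (\<nu> j w) (\<mu> j w)) (Dom J f) w) =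
       (\<lambda>j \<in> Obj J. \<lambda>w \<in> Obj (at_ob W j). Comp (at_ob X j) (\<nu> j w) (\<mu> j w))
         (Cod J f) (ob (at_ar W f) w)"
      using w dc[OF f] Wob[OF f w] m n f
      by (simp add: modification_def hom_def Xf.ar_Comp)
  qed (use m n in \<open>auto simp: modification_def\<close>)
  have ext: "\<mu> = (\<lambda>j \<in> Obj J. \<lambda>w \<in> Obj (at_ob W j). \<mu>' j w)"
    if "modification J W X \<alpha> \<beta> \<mu>" "\<And>j w. \<lbrakk>j \<in> Obj J; w \<in> Obj (at_ob W j)\<rbrakk> \<Longrightarrow> \<mu> j w = \<mu>' j w"
    for \<mu> \<mu>' \<alpha> \<beta>
    using that by (auto simp: modification_def nat_trans_def fun_eq_iff extensional_def)
  have cell: "\<mu> j w \<in> Arr (at_ob X j)" "Dom (at_ob X j) (\<mu> j w) = ob (\<alpha> j) w"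
      "Cod (at_ob X j) (\<mu> j w) = ob (\<beta> j) w"
    if "modification J W X \<alpha> \<beta> \<mu>" "j \<in> Obj J" "w \<in> Obj (at_ob W j)" for \<mu> \<alpha> \<beta> j w
    using that by (auto simp: modification_def nat_trans_def hom_def)
  show ?thesis
  proof
    fix f assume "f \<in> Arr (diag_hom J W X)"
    then obtain \<alpha> \<mu> \<beta> where f: "f = (\<alpha>, \<mu>, \<beta>)" "modification J W X \<alpha> \<beta> \<mu>"
      by (auto simp: diag_hom_def)
    show "Dom (diag_hom J W X) f \<in> Obj (diag_hom J W X)"
      "Cod (diag_hom J W X) f \<in> Obj (diag_hom J W X)"
      using f by (auto simp: diag_hom_def modification_def)
    show "Comp (diag_hom J W X) f (Ide (diag_hom J W X) (Dom (diag_hom J W X) f)) = f"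
      using f(1)
      by (simp add: diag_hom_def, intro ext[OF f(2), symmetric])
        (simp, metis X.at_ob_category category.Comp_Ide cell(1,2) f(2))
    show "Comp (diag_hom J W X) (Ide (diag_hom J W X) (Cod (diag_hom J W X) f)) f = f"
      using f(1)
      by (simp add: diag_hom_def, intro ext[OF f(2), symmetric])
        (simp, metis X.at_ob_category category.Ide_Comp cell(1,3) f(2))
  next
    fix a assume "a \<in> Obj (diag_hom J W X)"
    then show "Ide (diag_hom J W X) a \<in> hom (diag_hom J W X) a a"
      using id by (simp add: diag_hom_def hom_def)
  next
    fix f g assume "f \<in> Arr (diag_hom J W X)" "g \<in> Arr (diag_hom J W X)"
      "Cod (diag_hom J W X) f = Dom (diag_hom J W X) g"
    then show "Comp (diag_hom J W X) g f
        \<in> hom (diag_hom J W X) (Dom (diag_hom J W X) f) (Cod (diag_hom J W X) g)"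
      using comp by (auto simp: diag_hom_def hom_def)
  next
    fix f g h assume fgh: "f \<in> Arr (diag_hom J W X)" "g \<in> Arr (diag_hom J W X)"
      "h \<in> Arr (diag_hom J W X)" "Cod (diag_hom J W X) f = Dom (diag_hom J W X) g"
      "Cod (diag_hom J W X) g = Dom (diag_hom J W X) h"
    then obtain \<alpha> \<beta> \<gamma> \<delta> \<mu> \<nu> \<xi> where eq: "f = (\<alpha>, \<mu>, \<beta>)" "g = (\<beta>, \<nu>, \<gamma>)" "h = (\<gamma>, \<xi>, \<delta>)"
      and m: "modification J W X \<alpha> \<beta> \<mu>" "modification J W X \<beta> \<gamma> \<nu>" "modification J W X \<gamma> \<delta> \<xi>"
      by (auto simp: diag_hom_def)
    have "Comp (at_ob X j) (\<xi> j w) (Comp (at_ob X j) (\<nu> j w) (\<mu> j w)) =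
        Comp (at_ob X j) (Comp (at_ob X j) (\<xi> j w) (\<nu> j w)) (\<mu> j w)"
      if "j \<in> Obj J" "w \<in> Obj (at_ob W j)" for j w
      by (rule category.Comp_assoc[OF X.at_ob_category[OF that(1)]])
        (simp_all add: cell[OF m(1) that] cell[OF m(2) that] cell[OF m(3) that])
    then show "Comp (diag_hom J W X) h (Comp (diag_hom J W X) g f) =
        Comp (diag_hom J W X) (Comp (diag_hom J W X) h g) f"
      by (auto simp: eq diag_hom_def fun_eq_iff)
  qed
qed

lemma cat_functor_precomp:
  assumes phi: "diag_trans J V W \<phi>" and X: "diagram J X"
  shows "cat_functor (diag_hom J W X) (diag_hom J V X) (precomp_functor J V W X \<phi>)"
proof -
  have V: "diagram J V" and W: "diagram J W" using phi by (auto simp: diag_trans_def)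
  interpret V: diagram J V by fact
  interpret W: diagram J W by fact
  interpret X: diagram J X by fact
  interpret CW: category "diag_hom J W X" by (rule category_diag_hom) fact+
  interpret CV: category "diag_hom J V X" by (rule category_diag_hom) fact+
  have dc: "Dom J f \<in> Obj J" "Cod J f \<in> Obj J" if "f \<in> Arr J" for f
    using that V.J.Dom_in V.J.Cod_in by auto
  have pf: "cat_functor (at_ob V j) (at_ob W j) (\<phi> j)" if "j \<in> Obj J" for j
    using phi that by (simp add: diag_trans_def)
  have pob: "ob (\<phi> j) v \<in> Obj (at_ob W j)" if "j \<in> Obj J" "v \<in> Obj (at_ob V j)" for j v
    using cat_functor.ob_in[OF pf] that by blast
  have md: "modification J V X (comp_trans J V \<alpha> \<phi>) (comp_trans J V \<beta> \<phi>)
      (\<lambda>j \<in> Obj J. \<lambda>v \<in> Obj (at_ob V j). \<mu> j (ob (\<phi> j) v))"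
    if m: "modification J W X \<alpha> \<beta> \<mu>" for \<alpha> \<beta> \<mu>
    unfolding modification_def
  proof (intro conjI ballI)
    show "diag_trans J V X (comp_trans J V \<alpha> \<phi>)" "diag_trans J V X (comp_trans J V \<beta> \<phi>)"
      using m phi by (auto simp: modification_def intro: diag_trans_comp)
  next
    fix j assume j: "j \<in> Obj J"
    interpret p: cat_functor "at_ob V j" "at_ob W j" "\<phi> j" using pf j .
    have mj: "nat_trans (at_ob W j) (at_ob X j) (\<alpha> j) (\<beta> j) (\<mu> j)"
      using m j by (auto simp: modification_def)
    have "ar (\<phi> j) h \<in> Arr (at_ob W j)" "Dom (at_ob W j) (ar (\<phi> j) h) = ob (\<phi> j) (Dom (at_ob V j) h)"
      "Cod (at_ob W j) (ar (\<phi> j) h) = ob (\<phi> j) (Cod (at_ob V j) h)"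
      if "h \<in> Arr (at_ob V j)" for h
      using p.ar_in that by (auto simp: hom_def)
    then show "nat_trans (at_ob V j) (at_ob X j) (comp_trans J V \<alpha> \<phi> j) (comp_trans J V \<beta> \<phi> j)
       ((\<lambda>j \<in> Obj J. \<lambda>v \<in> Obj (at_ob V j). \<mu> j (ob (\<phi> j) v)) j)"
      using j mj p.cat_functor_axioms unfolding nat_trans_def
      by (simp add: comp_trans_def cat_functor_comp p.ob_in p.C.Dom_in p.C.Cod_in)
        (metis (no_types, lifting))
  next
    fix f v assume f: "f \<in> Arr J" and v: "v \<in> Obj (at_ob V (Dom J f))"
    have "ob (at_ar V f) v \<in> Obj (at_ob V (Cod J f))"
      using cat_functor.ob_in[OF V.at_ar_functor[OF f] v] .
    moreover have "ob (comp_functor (at_ob V (Dom J f)) (at_ar W f) (\<phi> (Dom J f))) v =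
          ob (comp_functor (at_ob V (Dom J f)) (\<phi> (Cod J f)) (at_ar V f)) v"
      using phi f by (simp add: diag_trans_def)
    ultimately show "ar (at_ar X f)
         ((\<lambda>j \<in> Obj J. \<lambda>v \<in> Obj (at_ob V j). \<mu> j (ob (\<phi> j) v)) (Dom J f) v) =
       (\<lambda>j \<in> Obj J. \<lambda>v \<in> Obj (at_ob V j). \<mu> j (ob (\<phi> j) v)) (Cod J f) (ob (at_ar V f) v)"
      using m f v dc[OF f] by (simp add: modification_def pob)
  qed simp
  show ?thesis
  proof
    show "ob (precomp_functor J V W X \<phi>) \<in> extensional (Obj (diag_hom J W X))"
      "ar (precomp_functor J V W X \<phi>) \<in> extensional (Arr (diag_hom J W X))"
      by (simp_all add: precomp_functor_def)
  next
    fix a assume a: "a \<in> Obj (diag_hom J W X)"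
    then show "ob (precomp_functor J V W X \<phi>) a \<in> Obj (diag_hom J V X)"
      using phi by (simp add: precomp_functor_def diag_hom_def diag_trans_comp)
    have "Ide (diag_hom J W X) a \<in> Arr (diag_hom J W X)" using CW.Ide_in[OF a] by (simp add: hom_def)
    with a show "ar (precomp_functor J V W X \<phi>) (Ide (diag_hom J W X) a) =
        Ide (diag_hom J V X) (ob (precomp_functor J V W X \<phi>) a)"
      by (auto simp: precomp_functor_def diag_hom_def fun_eq_iff comp_trans_def pob)
  next
    fix f assume f: "f \<in> Arr (diag_hom J W X)"
    then obtain \<alpha> \<mu> \<beta> where eq: "f = (\<alpha>, \<mu>, \<beta>)" "modification J W X \<alpha> \<beta> \<mu>"
      by (auto simp: diag_hom_def)
    then have "diag_trans J W X \<alpha>" "diag_trans J W X \<beta>" by (auto simp: modification_def)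
    with md[OF eq(2)] eq show "ar (precomp_functor J V W X \<phi>) f
       \<in> hom (diag_hom J V X) (ob (precomp_functor J V W X \<phi>) (Dom (diag_hom J W X) f))
           (ob (precomp_functor J V W X \<phi>) (Cod (diag_hom J W X) f))"
      by (simp add: precomp_functor_def diag_hom_def hom_def)
  next
    fix f g assume fg: "f \<in> Arr (diag_hom J W X)" "g \<in> Arr (diag_hom J W X)"
      "Cod (diag_hom J W X) f = Dom (diag_hom J W X) g"
    then have "Comp (diag_hom J W X) g f \<in> Arr (diag_hom J W X)"
      using CW.Comp_in by (auto simp: hom_def)
    with fg show "ar (precomp_functor J V W X \<phi>) (Comp (diag_hom J W X) g f) =
        Comp (diag_hom J V X) (ar (precomp_functor J V W X \<phi>) g) (ar (precomp_functor J V W X \<phi>) f)"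
      by (auto simp: precomp_functor_def diag_hom_def fun_eq_iff pob)
  qed
qed

lemma category_comma_under:
  assumes "cat_functor C D F"
  shows "category (comma_under C D F d)"
proof -
  interpret F: cat_functor C D F by fact
  have 1: "Comp C k h \<in> hom C a c \<and> Comp D (ar F (Comp C k h)) u = w"
    if "u \<in> hom D d (ob F a)" "h \<in> hom C a b" "k \<in> hom C b c"
      "Comp D (ar F h) u = v" "Comp D (ar F k) v = w" for a b c h k u v w
  proof -
    have h: "h \<in> Arr C" "Dom C h = a" "Cod C h = b" and k: "k \<in> Arr C" "Dom C k = b" "Cod C k = c"
      using that by (auto simp: hom_def)
    have "Comp D (ar F k) (Comp D (ar F h) u) = Comp D (Comp D (ar F k) (ar F h)) u"
      using that(1) F.ar_in[OF h(1)] F.ar_in[OF k(1)] h k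
      by (intro F.D.Comp_assoc) (auto simp: hom_def)
    with that h k F.C.Comp_in[of h k] show ?thesis by (simp add: F.ar_Comp)
  qed
  show ?thesis
  proof
    fix a assume "a \<in> Obj (comma_under C D F d)"
    then show "Ide (comma_under C D F d) a \<in> hom (comma_under C D F d) a a"
      using F.C.Ide_in by (auto simp: comma_under_def hom_def F.ar_Ide dest: F.D.Ide_Comp)
  next
    fix f g assume fg: "f \<in> Arr (comma_under C D F d)" "g \<in> Arr (comma_under C D F d)"
      "Cod (comma_under C D F d) f = Dom (comma_under C D F d) g"
    obtain a u h b v b' v' k c w where eq: "f = ((a, u), h, (b, v))" "g = ((b', v'), k, (c, w))"
      by (metis surj_pair)
    have "b' = b" "v' = v" using fg(3) by (simp_all add: eq comma_under_def)
    with fg 1[of u a h b k c v w] show "Comp (comma_under C D F d) g f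
        \<in> hom (comma_under C D F d) (Dom (comma_under C D F d) f) (Cod (comma_under C D F d) g)"
      unfolding hom_def[of "comma_under C D F d"] by (simp add: eq comma_under_def)
  next
    fix f assume f: "f \<in> Arr (comma_under C D F d)"
    obtain a u h b v where eq: "f = ((a, u), h, (b, v))" by (metis surj_pair)
    have "h \<in> Arr C" "Dom C h = a" "Cod C h = b" using f by (auto simp: eq comma_under_def hom_def)
    then show "Comp (comma_under C D F d) f (Ide (comma_under C D F d) (Dom (comma_under C D F d) f)) = f"
      "Comp (comma_under C D F d) (Ide (comma_under C D F d) (Cod (comma_under C D F d) f)) f = f"
      using F.C.Comp_Ide[of h] F.C.Ide_Comp[of h] by (simp_all add: eq comma_under_def)
    show "Dom (comma_under C D F d) f \<in> Obj (comma_under C D F d)"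
      "Cod (comma_under C D F d) f \<in> Obj (comma_under C D F d)"
      using f by (simp_all add: eq comma_under_def)
  next
    fix f g l assume fgl: "f \<in> Arr (comma_under C D F d)" "g \<in> Arr (comma_under C D F d)"
      "l \<in> Arr (comma_under C D F d)" "Cod (comma_under C D F d) f = Dom (comma_under C D F d) g"
      "Cod (comma_under C D F d) g = Dom (comma_under C D F d) l"
    obtain x h y y' k z z' m t where eq: "f = (x, h, y)" "g = (y', k, z)" "l = (z', m, t)"
      by (metis surj_pair)
    have "h \<in> Arr C" "k \<in> Arr C" "m \<in> Arr C" "Cod C h = Dom C k" "Cod C k = Dom C m"
      using fgl by (auto simp: eq comma_under_def hom_def)
    then show "Comp (comma_under C D F d) l (Comp (comma_under C D F d) g f) =
        Comp (comma_under C D F d) (Comp (comma_under C D F d) l g) f"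
      by (simp add: eq comma_under_def F.C.Comp_assoc)
  qed
qed

lemma cat_functor_Delta:
  assumes "diagram J W" "diagram J X"
  shows "cat_functor (diag_hom J terminal_diag X) (diag_hom J W X) (Delta J W X)"
  unfolding Delta_def by (rule cat_functor_precomp) (use assms in \<open>auto intro: diag_trans_to_terminal\<close>)

end

theory Submission
  imports Defs
begin

text \<open>
  Given \<open>\<alpha> : W \<Rightarrow> X\<close>, choose a colimit \<open>c\<^sub>j\<close> of each \<open>\<alpha>\<^sub>j\<close>. For \<open>f : j \<rightarrow> k\<close>, preservation makes
  \<open>X\<^sub>f c\<^sub>j\<close> a colimit of \<open>X\<^sub>f \<alpha>\<^sub>j = \<alpha>\<^sub>k W\<^sub>f\<close>, and finality makes \<open>c\<^sub>k\<close> one as well, so there are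
  canonical isomorphisms \<open>\<theta>\<^sub>f : X\<^sub>f c\<^sub>j \<cong> c\<^sub>k\<close> satisfying the cocycle condition: the \<open>c\<^sub>j\<close> form a
  pseudo-cone over \<open>X\<close>. A pseudo-cone is the same as a strict map to \<open>X\<close> from the diagram sending
  \<open>j\<close> to the indiscrete category on the arrows of \<open>J\<close> with codomain \<open>j\<close>. Adjoining to each of these a
  further point fixed by the transition functors is a levelwise trivial cofibration, so by fibrancy
  the map extends, and the images of the new points are a strict cone \<open>d\<close> with compatible
  isomorphisms \<open>c\<^sub>j \<cong> d\<^sub>j\<close>. Carried along these, the colimit cocones become a universal arrow from \<open>\<alpha>\<close>
  to \<open>\<Delta> d\<close>.
\<close>

section \<open>Composition in hom-sets\<close>

lemma homD:
  "f \<in> hom C a b \<Longrightarrow> f \<in> Arr C"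
  "f \<in> hom C a b \<Longrightarrow> Dom C f = a"
  "f \<in> hom C a b \<Longrightarrow> Cod C f = b"
  by (auto simp: hom_def)

lemma Arr_hom: "f \<in> Arr C \<Longrightarrow> f \<in> hom C (Dom C f) (Cod C f)"
  by (simp add: hom_def)

context category
begin

lemma hom_Obj: "f \<in> hom C a b \<Longrightarrow> a \<in> Obj C" "f \<in> hom C a b \<Longrightarrow> b \<in> Obj C"
  using Dom_in Cod_in by (auto simp: hom_def)

lemma comp_hom: "f \<in> hom C a b \<Longrightarrow> g \<in> hom C b c \<Longrightarrow> Comp C g f \<in> hom C a c"
  using Comp_in[of f g] by (auto simp: hom_def)

lemma comp_ide_right: "f \<in> hom C a b \<Longrightarrow> Comp C f (Ide C a) = f"
  and comp_ide_left: "f \<in> hom C a b \<Longrightarrow> Comp C (Ide C b) f = f"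
  using Comp_Ide[of f] Ide_Comp[of f] by (auto simp: hom_def)

lemma comp_assoc:
  "f \<in> hom C a b \<Longrightarrow> g \<in> hom C b c \<Longrightarrow> h \<in> hom C c d \<Longrightarrow>
    Comp C h (Comp C g f) = Comp C (Comp C h g) f"
  using Comp_assoc[of f g h] by (auto simp: hom_def)

end

lemma iso_arr_obtain:
  assumes "iso_arr C f" "f \<in> hom C a b"
  obtains g where "g \<in> hom C b a" "Comp C g f = Ide C a" "Comp C f g = Ide C b"
  using assms by (auto simp: iso_arr_def hom_def)

context cat_functor
begin

lemma ar_hom: "f \<in> hom C a b \<Longrightarrow> ar F f \<in> hom D (ob F a) (ob F b)"
  using ar_in[of f] by (auto simp: hom_def)

lemma ar_comp: "f \<in> hom C a b \<Longrightarrow> g \<in> hom C b c \<Longrightarrow> ar F (Comp C g f) = Comp D (ar F g) (ar F f)"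
  by (rule ar_Comp) (auto simp: hom_def)

end

lemma cat_functor_const:
  assumes "category C" "category D" "d \<in> Obj D"
  shows "cat_functor C D (const_functor C D d)"
proof -
  interpret C: category C by fact
  interpret D: category D by fact
  show ?thesis
    using D.Ide_in[OF assms(3)] D.comp_ide_left[OF D.Ide_in[OF assms(3)]] C.Ide_in C.Comp_in assms(3)
    by unfold_locales (auto simp: const_functor_def hom_def C.Dom_in C.Cod_in)
qed


section \<open>Adjoints from universal arrows\<close>

text \<open>A choice of universal arrows \<open>\<eta> c\<close> from \<open>c\<close> to
  \<open>G\<close> determines the adjoint: \<open>f\<close> goes to the transpose of
  \<open>\<eta>\<close> after \<open>f\<close>. The remaining equations are checked after
  transposing back along \<open>\<eta>\<close>.\<close>

lemma admits_left_adjoint_if_universal_arrows: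
  fixes D :: "('p, 'n) cat" and C :: "('o, 'm) cat"
  assumes G: "cat_functor D C G"
    and univ: "\<And>c. c \<in> Obj C \<Longrightarrow> \<exists>d \<eta>. d \<in> Obj D \<and> \<eta> \<in> hom C c (ob G d) \<and>
      (\<forall>d' \<in> Obj D. \<forall>g \<in> hom C c (ob G d'). \<exists>!h. h \<in> hom D d d' \<and> Comp C (ar G h) \<eta> = g)"
  shows "admits_left_adjoint D C G"
proof -
  interpret G: cat_functor D C G by fact
  obtain L \<eta> where L: "\<And>c. c \<in> Obj C \<Longrightarrow> L c \<in> Obj D"
    and eta: "\<And>c. c \<in> Obj C \<Longrightarrow> \<eta> c \<in> hom C c (ob G (L c))"
    and univ': "\<And>c d g. c \<in> Obj C \<Longrightarrow> d \<in> Obj D \<Longrightarrow> g \<in> hom C c (ob G d) \<Longrightarrow>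
      \<exists>!h. h \<in> hom D (L c) d \<and> Comp C (ar G h) (\<eta> c) = g"
    using univ by metis
  \<comment> \<open>The transpose of \<open>g\<close>: its image under the bijection between arrows
    from \<open>c\<close> to \<open>G d\<close> and arrows from \<open>L c\<close> to
    \<open>d\<close>.\<close>
  define ext where "ext c d g = (THE h. h \<in> hom D (L c) d \<and> Comp C (ar G h) (\<eta> c) = g)" for c d g
  have ext: "ext c d g \<in> hom D (L c) d" "Comp C (ar G (ext c d g)) (\<eta> c) = g"
    if "c \<in> Obj C" "d \<in> Obj D" "g \<in> hom C c (ob G d)" for c d g
    using theI'[OF univ'[OF that]] unfolding ext_def by auto
  \<comment> \<open>Arrows out of \<open>L c\<close> agree as soon as their transposes agree. The
    functor laws, naturality of \<open>\<epsilon>\<close> and the first triangle identity all reduce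
    to this.\<close>
  have uniq: "h = h'" if "h \<in> hom D (L c) d" "h' \<in> hom D (L c) d" "c \<in> Obj C"
      "Comp C (ar G h) (\<eta> c) = Comp C (ar G h') (\<eta> c)" for c d h h'
    using univ'[OF that(3) G.C.hom_Obj(2)[OF that(1)], of "Comp C (ar G h) (\<eta> c)"]
      G.D.comp_hom[OF eta[OF that(3)] G.ar_hom[OF that(1)]] that by metis
  have two: "Comp C (ar G (Comp D k h)) (\<eta> c) = Comp C (ar G k) (Comp C (ar G h) (\<eta> c))"
    if "c \<in> Obj C" "h \<in> hom D (L c) d" "k \<in> hom D d d'" for c d d' h k
    using G.ar_comp[OF that(2,3)]
      G.D.comp_assoc[OF eta[OF that(1)] G.ar_hom[OF that(2)] G.ar_hom[OF that(3)]] by simp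
  define M where "M f = ext (Dom C f) (L (Cod C f)) (Comp C (\<eta> (Cod C f)) f)" for f
  have M: "M f \<in> hom D (L a) (L b)" "Comp C (ar G (M f)) (\<eta> a) = Comp C (\<eta> b) f"
    if "f \<in> hom C a b" for f a b
    using ext[OF G.D.hom_Obj(1)[OF that] L[OF G.D.hom_Obj(2)[OF that]]
        G.D.comp_hom[OF that eta[OF G.D.hom_Obj(2)[OF that]]]] that
    by (auto simp: M_def hom_def)
  define F where "F = \<lparr>ob = restrict L (Obj C), ar = restrict M (Arr C)\<rparr>"
  \<comment> \<open>The counit is the transpose of an identity, so the second triangle identity
    holds by construction, as \<open>eps(2)\<close>.\<close>
  define \<epsilon> where "\<epsilon> = (\<lambda>d \<in> Obj D. ext (ob G d) d (Ide C (ob G d)))"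
  have eps: "\<epsilon> d \<in> hom D (L (ob G d)) d" "Comp C (ar G (\<epsilon> d)) (\<eta> (ob G d)) = Ide C (ob G d)"
    if "d \<in> Obj D" for d
    using ext[OF G.ob_in[OF that] that G.D.Ide_in[OF G.ob_in[OF that]]] that by (auto simp: \<epsilon>_def)
  have F: "cat_functor C D F"
  proof
    show "ob F \<in> extensional (Obj C)" "ar F \<in> extensional (Arr C)" by (auto simp: F_def)
    fix a assume a: "a \<in> Obj C"
    show "ob F a \<in> Obj D" using L a by (simp add: F_def)
    have I: "Ide C a \<in> hom C a a" using G.D.Ide_in a .
    have "M (Ide C a) = Ide D (L a)"
    proof (rule uniq[OF M(1)[OF I] G.C.Ide_in[OF L[OF a]] a])
      show "Comp C (ar G (M (Ide C a))) (\<eta> a) = Comp C (ar G (Ide D (L a))) (\<eta> a)"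
        using M(2)[OF I] eta[OF a] a L by (simp add: G.ar_Ide G.D.comp_ide_left G.D.comp_ide_right)
    qed
    then show "ar F (Ide C a) = Ide D (ob F a)" using a I by (simp add: F_def homD)
  next
    fix f assume "f \<in> Arr C"
    then show "ar F f \<in> hom D (ob F (Dom C f)) (ob F (Cod C f))"
      using M(1)[OF Arr_hom] by (simp add: F_def G.D.Dom_in G.D.Cod_in)
  next
    fix f g assume fg: "f \<in> Arr C" "g \<in> Arr C" "Cod C f = Dom C g"
    let ?a = "Dom C f" and ?b = "Cod C f" and ?c = "Cod C g"
    have f: "f \<in> hom C ?a ?b" and g: "g \<in> hom C ?b ?c" using fg by (auto simp: hom_def)
    note gf = G.D.comp_hom[OF f g]
    have a: "?a \<in> Obj C" and b: "?b \<in> Obj C" and c: "?c \<in> Obj C" using fg G.D.Dom_in G.D.Cod_in by auto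
    have "M (Comp C g f) = Comp D (M g) (M f)"
    proof (rule uniq[OF M(1)[OF gf] G.C.comp_hom[OF M(1)[OF f] M(1)[OF g]] a])
      show "Comp C (ar G (M (Comp C g f))) (\<eta> ?a) = Comp C (ar G (Comp D (M g) (M f))) (\<eta> ?a)"
        by (simp add: two[OF a M(1)[OF f] M(1)[OF g]] M(2)[OF f] M(2)[OF gf] M(2)[OF g]
            G.D.comp_assoc[OF f g eta[OF c]]
            G.D.comp_assoc[OF f eta[OF b] G.ar_hom[OF M(1)[OF g]]])
    qed
    then show "ar F (Comp C g f) = Comp D (ar F g) (ar F f)" using fg gf by (simp add: F_def homD)
  qed
  interpret F: cat_functor C D F by (rule F)
  let ?\<eta> = "restrict \<eta> (Obj C)"
  have obF: "ob F c = L c" if "c \<in> Obj C" for c using that by (simp add: F_def)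
  have arF: "ar F f = M f" if "f \<in> Arr C" for f using that by (simp add: F_def)
  have "nat_trans C C (id_functor C) (comp_functor C G F) ?\<eta>"
    unfolding nat_trans_def
  proof (intro conjI ballI)
    show "cat_functor C C (id_functor C)" by (rule cat_functor_id) (rule G.D.category_axioms)
    show "cat_functor C C (comp_functor C G F)" by (rule cat_functor_comp) fact+
    fix f assume f: "f \<in> Arr C"
    show "Comp C (ar (comp_functor C G F) f) (?\<eta> (Dom C f)) =
         Comp C (?\<eta> (Cod C f)) (ar (id_functor C) f)"
      using M(2)[OF Arr_hom[OF f]] f by (simp add: arF id_functor_def G.D.Dom_in G.D.Cod_in)
  qed (use eta in \<open>auto simp: id_functor_def obF\<close>)
  moreover have "nat_trans D D (comp_functor D F G) (id_functor D) \<epsilon>"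
    unfolding nat_trans_def
  proof (intro conjI ballI)
    show "cat_functor D D (id_functor D)" by (rule cat_functor_id) (rule G.C.category_axioms)
    show "cat_functor D D (comp_functor D F G)" by (rule cat_functor_comp) fact+
    show "\<epsilon> \<in> extensional (Obj D)" by (simp add: \<epsilon>_def)
    fix a assume "a \<in> Obj D"
    then show "\<epsilon> a \<in> hom D (ob (comp_functor D F G) a) (ob (id_functor D) a)"
      using eps(1) by (simp add: obF G.ob_in id_functor_def)
  next
    fix f assume f: "f \<in> Arr D"
    let ?a = "Dom D f" and ?b = "Cod D f"
    have a: "?a \<in> Obj D" and b: "?b \<in> Obj D" using f G.C.Dom_in G.C.Cod_in by auto
    note fh = Arr_hom[OF f]
    note Gf = G.ar_hom[OF fh]
    have "Comp D f (\<epsilon> ?a) = Comp D (\<epsilon> ?b) (M (ar G f))"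
    proof (rule uniq[OF G.C.comp_hom[OF eps(1)[OF a] fh] G.C.comp_hom[OF M(1)[OF Gf] eps(1)[OF b]]
            G.ob_in[OF a]])
      show "Comp C (ar G (Comp D f (\<epsilon> ?a))) (\<eta> (ob G ?a)) =
            Comp C (ar G (Comp D (\<epsilon> ?b) (M (ar G f)))) (\<eta> (ob G ?a))"
        by (simp add: two[OF G.ob_in[OF a] eps(1)[OF a] fh] two[OF G.ob_in[OF a] M(1)[OF Gf] eps(1)[OF b]]
            eps(2)[OF a] M(2)[OF Gf] eps(2)[OF b] G.D.comp_ide_right[OF Gf] G.D.comp_ide_left[OF Gf]
            G.D.comp_assoc[OF Gf eta[OF G.ob_in[OF b]] G.ar_hom[OF eps(1)[OF b]]])
    qed
    then show "Comp D (ar (id_functor D) f) (\<epsilon> ?a) = Comp D (\<epsilon> ?b) (ar (comp_functor D F G) f)"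
      using f homD(1)[OF Gf] by (simp add: id_functor_def arF)
  qed
  moreover have "Comp D (\<epsilon> (ob F c)) (ar F (?\<eta> c)) = Ide D (ob F c)" if c: "c \<in> Obj C" for c
  proof -
    note e = eta[OF c] and Lc = L[OF c]
    have "Comp D (\<epsilon> (L c)) (M (\<eta> c)) = Ide D (L c)"
    proof (rule uniq[OF G.C.comp_hom[OF M(1)[OF e] eps(1)[OF Lc]] G.C.Ide_in[OF Lc] c])
      show "Comp C (ar G (Comp D (\<epsilon> (L c)) (M (\<eta> c)))) (\<eta> c) = Comp C (ar G (Ide D (L c))) (\<eta> c)"
        by (simp add: two[OF c M(1)[OF e] eps(1)[OF Lc]] M(2)[OF e] eps(2)[OF Lc] G.ar_Ide[OF Lc]
            G.D.comp_assoc[OF e eta[OF G.ob_in[OF Lc]] G.ar_hom[OF eps(1)[OF Lc]]])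
    qed
    then show ?thesis using c homD(1)[OF e] by (simp add: obF arF)
  qed
  moreover have "Comp C (ar G (\<epsilon> d)) (?\<eta> (ob G d)) = Ide C (ob G d)" if "d \<in> Obj D" for d
    using eps(2)[OF that] G.ob_in[OF that] by simp
  ultimately show ?thesis unfolding admits_left_adjoint_def adjunction_def using F G by blast
qed


section \<open>Colimit cocones\<close>

text \<open>Against a constant functor the naturality square collapses to a triangle once the
  identity of \<open>c\<close> is cancelled. The cancellation needs the components to be arrows into
  \<open>c\<close>; if they are not, both sides fail, whence the case distinction.\<close>

lemma cocone_iff:
  assumes "cat_functor I C K"
  shows "cocone I C K c \<iota> \<longleftrightarrow> c \<in> Obj C \<and> \<iota> \<in> extensional (Obj I) \<and>
    (\<forall>i \<in> Obj I. \<iota> i \<in> hom C (ob K i) c) \<and>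
    (\<forall>i j. \<forall>f \<in> hom I i j. Comp C (\<iota> j) (ar K f) = \<iota> i)"
proof (cases "c \<in> Obj C \<and> (\<forall>i \<in> Obj I. \<iota> i \<in> hom C (ob K i) c)")
  case True
  interpret K: cat_functor I C K by fact
  have c: "cat_functor I C (const_functor I C c)"
    by (rule cat_functor_const) (use True K.C.category_axioms K.D.category_axioms in auto)
  have "(Comp C (ar (const_functor I C c) f) (\<iota> (Dom I f)) = Comp C (\<iota> (Cod I f)) (ar K f)) \<longleftrightarrow>
     (Comp C (\<iota> (Cod I f)) (ar K f) = \<iota> (Dom I f))" if "f \<in> Arr I" for f
    using that True K.C.Dom_in[OF that] K.D.comp_ide_left[of "\<iota> (Dom I f)" "ob K (Dom I f)" c]
    by (auto simp: const_functor_def)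
  then show ?thesis
    using True assms c by (auto simp: cocone_def nat_trans_def hom_def const_functor_def)
next
  case False
  then show ?thesis using assms by (auto simp: cocone_def nat_trans_def const_functor_def)
qed

lemma coconeD:
  assumes "cocone I C K c \<iota>"
  shows "cat_functor I C K" "c \<in> Obj C" "\<iota> \<in> extensional (Obj I)"
    "\<And>i. i \<in> Obj I \<Longrightarrow> \<iota> i \<in> hom C (ob K i) c"
    "\<And>i j f. f \<in> hom I i j \<Longrightarrow> Comp C (\<iota> j) (ar K f) = \<iota> i"
proof -
  show K: "cat_functor I C K" using assms by (auto simp: cocone_def nat_trans_def)
  show "c \<in> Obj C" "\<iota> \<in> extensional (Obj I)"
    "\<And>i. i \<in> Obj I \<Longrightarrow> \<iota> i \<in> hom C (ob K i) c"
    "\<And>i j f. f \<in> hom I i j \<Longrightarrow> Comp C (\<iota> j) (ar K f) = \<iota> i"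
    using assms unfolding cocone_iff[OF K] by auto
qed

lemma cocone_comp:
  assumes "cocone I C K c \<iota>" "h \<in> hom C c d"
  shows "cocone I C K d (\<lambda>i \<in> Obj I. Comp C h (\<iota> i))"
proof -
  note K = coconeD(1)[OF assms(1)] and io = coconeD(4,5)[OF assms(1)]
  interpret K: cat_functor I C K by (rule K)
  have "Comp C (Comp C h (\<iota> j)) (ar K f) = Comp C h (\<iota> i)" if "f \<in> hom I i j" for i j f
    using K.D.comp_assoc[OF K.ar_hom[OF that] io(1)[OF K.C.hom_Obj(2)[OF that]] assms(2)] io(2)[OF that]
    by simp
  then show ?thesis
    unfolding cocone_iff[OF K] using K.D.hom_Obj[OF assms(2)] K.D.comp_hom[OF io(1) assms(2)] K.C.hom_Obj
    by auto
qed

section \<open>Universal property and uniqueness of colimits\<close>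

lemma colimit_cocone: "is_colimit I C K c \<iota> \<Longrightarrow> cocone I C K c \<iota>"
  by (simp add: is_colimit_def)

text \<open>Both arrows factor one and the same cocone, and factorisations are unique: the legs of a
  colimit cocone are jointly epic.\<close>

lemma colimit_hom_eqI:
  assumes "is_colimit I C K c \<iota>" "h \<in> hom C c d" "h' \<in> hom C c d"
    and "\<And>i. i \<in> Obj I \<Longrightarrow> Comp C h (\<iota> i) = Comp C h' (\<iota> i)"
  shows "h = h'"
proof -
  have "cocone I C K d (\<lambda>i \<in> Obj I. Comp C h (\<iota> i))"
    by (rule cocone_comp[OF colimit_cocone]) fact+
  then have "\<exists>!k. k \<in> hom C c d \<and> (\<forall>i \<in> Obj I. Comp C k (\<iota> i) = (\<lambda>i \<in> Obj I. Comp C h (\<iota> i)) i)"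
    using assms(1) unfolding is_colimit_def by blast
  then show ?thesis using assms(2-4) by (metis restrict_apply')
qed

lemma colimit_factor:
  assumes "is_colimit I C K c \<iota>" "cocone I C K d \<kappa>"
  obtains h where "h \<in> hom C c d" "\<And>i. i \<in> Obj I \<Longrightarrow> Comp C h (\<iota> i) = \<kappa> i"
  using assms unfolding is_colimit_def by blast

text \<open>Separates the existence of factorisations from their uniqueness, the latter in the form
  of joint epicity of the legs.\<close>

lemma is_colimitI:
  assumes "cocone I C K c \<iota>"
    and "\<And>d \<kappa>. cocone I C K d \<kappa> \<Longrightarrow> \<exists>h \<in> hom C c d. \<forall>i \<in> Obj I. Comp C h (\<iota> i) = \<kappa> i"
    and "\<And>d h h'. \<lbrakk>h \<in> hom C c d; h' \<in> hom C c d; \<And>i. i \<in> Obj I \<Longrightarrow> Comp C h (\<iota> i) = Comp C h' (\<iota> i)\<rbrakk>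
      \<Longrightarrow> h = h'"
  shows "is_colimit I C K c \<iota>"
  unfolding is_colimit_def
proof (intro conjI allI impI)
  fix d \<kappa> assume k: "cocone I C K d \<kappa>"
  show "\<exists>!h. h \<in> hom C c d \<and> (\<forall>i \<in> Obj I. Comp C h (\<iota> i) = \<kappa> i)"
  proof (rule ex_ex1I)
    show "\<exists>h. h \<in> hom C c d \<and> (\<forall>i \<in> Obj I. Comp C h (\<iota> i) = \<kappa> i)" using assms(2)[OF k] by blast
  qed (rule assms(3), auto)
qed fact

text \<open>A cocone factors through the new legs by its old factorisation after the inverse of
  \<open>t\<close>. This serves to move chosen colimits onto a strict cone.\<close>

lemma colimit_iso:
  assumes "is_colimit I C K c \<iota>" "t \<in> hom C c d" "iso_arr C t"
  shows "is_colimit I C K d (\<lambda>i \<in> Obj I. Comp C t (\<iota> i))"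
proof (rule is_colimitI)
  note co = colimit_cocone[OF assms(1)]
  interpret K: cat_functor I C K by (rule coconeD(1)[OF co])
  note io = coconeD(4)[OF co]
  obtain s where s: "s \<in> hom C d c" "Comp C s t = Ide C c" "Comp C t s = Ide C d"
    using iso_arr_obtain[OF assms(3,2)] .
  show "cocone I C K d (\<lambda>i \<in> Obj I. Comp C t (\<iota> i))" by (rule cocone_comp[OF co assms(2)])
  show "\<exists>h \<in> hom C d e. \<forall>i \<in> Obj I. Comp C h ((\<lambda>i \<in> Obj I. Comp C t (\<iota> i)) i) = \<kappa> i"
    if k: "cocone I C K e \<kappa>" for e \<kappa>
  proof -
    obtain h where h: "h \<in> hom C c e" "\<And>i. i \<in> Obj I \<Longrightarrow> Comp C h (\<iota> i) = \<kappa> i"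
      using colimit_factor[OF assms(1) k] by blast
    have "Comp C (Comp C h s) (Comp C t (\<iota> i)) = \<kappa> i" if "i \<in> Obj I" for i
      using h(2)[OF that] K.D.comp_assoc[OF io[OF that] assms(2) K.D.comp_hom[OF s(1) h(1)]]
        K.D.comp_assoc[OF assms(2) s(1) h(1)] K.D.comp_ide_right[OF h(1)] s(2) by simp
    then show ?thesis using K.D.comp_hom[OF s(1) h(1)] by auto
  qed
  show "h = h'" if hh: "h \<in> hom C d e" "h' \<in> hom C d e"
    and eq: "\<And>i. i \<in> Obj I \<Longrightarrow> Comp C h ((\<lambda>i \<in> Obj I. Comp C t (\<iota> i)) i) =
         Comp C h' ((\<lambda>i \<in> Obj I. Comp C t (\<iota> i)) i)" for e h h'
  proof -
    have "Comp C h t = Comp C h' t"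
      by (rule colimit_hom_eqI[OF assms(1) K.D.comp_hom[OF assms(2) hh(1)] K.D.comp_hom[OF assms(2) hh(2)]])
        (use eq in \<open>simp add: K.D.comp_assoc[OF io assms(2) hh(1)] K.D.comp_assoc[OF io assms(2) hh(2)]\<close>)
    then have "Comp C (Comp C h t) s = Comp C (Comp C h' t) s" by simp
    then show ?thesis
      by (simp add: K.D.comp_assoc[OF s(1) assms(2) hh(1), symmetric] s(3) K.D.comp_ide_right[OF hh(1)]
          K.D.comp_assoc[OF s(1) assms(2) hh(2), symmetric] K.D.comp_ide_right[OF hh(2)])
  qed
qed

text \<open>The source of the comparison isomorphisms \<open>\<theta>\<close>: the two mutual
  factorisations are inverse to each other because both composites fix the legs.\<close>

lemma colimit_unique_iso:
  assumes "is_colimit I C K c \<iota>" "is_colimit I C K d \<kappa>"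
  obtains h where "h \<in> hom C c d" "iso_arr C h" "\<And>i. i \<in> Obj I \<Longrightarrow> Comp C h (\<iota> i) = \<kappa> i"
proof -
  obtain h where h: "h \<in> hom C c d" "\<And>i. i \<in> Obj I \<Longrightarrow> Comp C h (\<iota> i) = \<kappa> i"
    using colimit_factor[OF assms(1) colimit_cocone[OF assms(2)]] by blast
  obtain k where k: "k \<in> hom C d c" "\<And>i. i \<in> Obj I \<Longrightarrow> Comp C k (\<kappa> i) = \<iota> i"
    using colimit_factor[OF assms(2) colimit_cocone[OF assms(1)]] by blast
  note ci = coconeD[OF colimit_cocone[OF assms(1)]] and di = coconeD[OF colimit_cocone[OF assms(2)]]
  interpret K: cat_functor I C K by (rule ci(1))
  have "Comp C k h = Ide C c"
    by (rule colimit_hom_eqI[OF assms(1) K.D.comp_hom[OF h(1) k(1)] K.D.Ide_in[OF ci(2)]])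
      (simp add: K.D.comp_assoc[OF ci(4) h(1) k(1), symmetric] h(2) k(2) K.D.comp_ide_left[OF ci(4)])
  moreover have "Comp C h k = Ide C d"
    by (rule colimit_hom_eqI[OF assms(2) K.D.comp_hom[OF k(1) h(1)] K.D.Ide_in[OF di(2)]])
      (simp add: K.D.comp_assoc[OF di(4) k(1) h(1), symmetric] h(2) k(2) K.D.comp_ide_left[OF di(4)])
  ultimately have "iso_arr C h" using h(1) k(1) by (auto simp: iso_arr_def hom_def)
  then show ?thesis using that h by blast
qed

text \<open>A cocone \<open>\<kappa>\<close> on the restricted diagram extends to all of
  \<open>I'\<close>: at \<open>a\<close>, pick any \<open>u\<close> from \<open>a\<close> to
  \<open>F i\<close> and take \<open>\<kappa> i\<close> after \<open>K u\<close>. Such a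
  \<open>u\<close> exists because the comma category is non-empty, and the result does not depend on
  it because the comma category is connected.\<close>

lemma colimit_final:
  assumes fin: "final_functor I I' F" and col: "is_colimit I' C K c \<iota>"
  shows "is_colimit I C (comp_functor I K F) c (\<lambda>i \<in> Obj I. \<iota> (ob F i))"
proof -
  note co = colimit_cocone[OF col]
  note io = coconeD[OF co]
  interpret K: cat_functor I' C K by (rule io(1))
  interpret F: cat_functor I I' F using fin by (simp add: final_functor_def)
  have KF: "cat_functor I C (comp_functor I K F)"
    by (rule cat_functor_comp[OF F.cat_functor_axioms K.cat_functor_axioms])
  have cc: "cocone I C (comp_functor I K F) c (\<lambda>i \<in> Obj I. \<iota> (ob F i))"
    unfolding cocone_iff[OF KF] using io(2,4) io(5)[OF F.ar_hom] F.ob_in F.C.hom_Obj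
    by (auto simp: homD)
  show ?thesis
  proof (rule is_colimitI[OF cc])
    fix d \<kappa> assume "cocone I C (comp_functor I K F) d \<kappa>"
    note ka = coconeD[OF this]
    have ka4: "\<kappa> i \<in> hom C (ob K (ob F i)) d" if "i \<in> Obj I" for i using ka(4)[OF that] that by simp
    have ka5: "Comp C (\<kappa> j) (ar K (ar F h)) = \<kappa> i" if "h \<in> hom I i j" for h i j
      using ka(5)[OF that] homD(1)[OF that] by simp
    let ?CM = "comma_under I I' F"
    \<comment> \<open>The candidate leg at \<open>a\<close>, computed from an object
      \<open>(i, u)\<close> of the comma category; \<open>step\<close> makes it invariant along
      single arrows, \<open>indep\<close> along zigzags.\<close>
    let ?v = "\<lambda>(i, u). Comp C (\<kappa> i) (ar K u)"
    have step: "?v x = ?v y" if "h \<in> hom (?CM a) x y" for a x y h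
    proof -
      obtain i u j w k where xy: "x = (i, u)" "y = (j, w)" "h = (x, k, y)"
        using \<open>h \<in> hom (?CM a) x y\<close> by (cases x; cases y) (auto simp: hom_def comma_under_def)
      then have i: "i \<in> Obj I" "j \<in> Obj I" and u: "u \<in> hom I' a (ob F i)" and w: "Comp I' (ar F k) u = w"
        and k: "k \<in> hom I i j" using \<open>h \<in> hom (?CM a) x y\<close> by (auto simp: hom_def comma_under_def)
      have "Comp C (\<kappa> j) (ar K w) = Comp C (\<kappa> j) (Comp C (ar K (ar F k)) (ar K u))"
        using K.ar_comp[OF u F.ar_hom[OF k]] w by simp
      also have "\<dots> = Comp C (\<kappa> i) (ar K u)"
        using K.D.comp_assoc[OF K.ar_hom[OF u] K.ar_hom[OF F.ar_hom[OF k]] ka4[OF i(2)]] ka5[OF k] by simp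
      finally show ?thesis by (simp add: xy)
    qed
    have indep: "?v x = ?v y" if "a \<in> Obj I'" "x \<in> Obj (?CM a)" "y \<in> Obj (?CM a)" for a x y
    proof -
      have "(x, y) \<in> {(x, y). hom (?CM a) x y \<noteq> {} \<or> hom (?CM a) y x \<noteq> {}}\<^sup>*"
        using fin that by (auto simp: final_functor_def connected_category_def)
      then show ?thesis
        by (induction rule: rtrancl_induct) (auto dest: step[of _ a])
    qed
    define p where "p a = (SOME x. x \<in> Obj (?CM a))" for a
    have p: "p a \<in> Obj (?CM a)" if "a \<in> Obj I'" for a
      using fin that some_in_eq[of "Obj (?CM a)"]
      by (auto simp: p_def final_functor_def connected_category_def)
    define \<tau> where "\<tau> = (\<lambda>a \<in> Obj I'. ?v (p a))"
    \<comment> \<open>Frees \<open>\<tau> a\<close> from the choice made by \<open>p\<close>, so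
      that each later equation may use the most convenient \<open>u\<close>.\<close>
    have lam: "\<tau> a = Comp C (\<kappa> i) (ar K u)" if "i \<in> Obj I" "u \<in> hom I' a (ob F i)" for a i u
      using indep[OF _ p, of a "(i, u)"] that K.C.hom_Obj(1)[OF that(2)]
      by (simp add: \<tau>_def comma_under_def)
    have pex: "\<exists>i u. i \<in> Obj I \<and> u \<in> hom I' a (ob F i)" if "a \<in> Obj I'" for a
      using p[OF that] by (auto simp: comma_under_def)
    have "cocone I' C K d \<tau>"
      unfolding cocone_iff[OF io(1)]
    proof (intro conjI ballI allI)
      show "d \<in> Obj C" by (rule ka(2))
      show "\<tau> \<in> extensional (Obj I')" by (simp add: \<tau>_def)
      fix a assume "a \<in> Obj I'"
      then obtain i u where i: "i \<in> Obj I" "u \<in> hom I' a (ob F i)" using pex by blast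
      then show "\<tau> a \<in> hom C (ob K a) d"
        using K.D.comp_hom[OF K.ar_hom[OF i(2)] ka4[OF i(1)]] lam by simp
    next
      fix a b f assume f: "f \<in> hom I' a b"
      obtain i u where i: "i \<in> Obj I" "u \<in> hom I' b (ob F i)"
        using pex[OF K.C.hom_Obj(2)[OF f]] by blast
      then show "Comp C (\<tau> b) (ar K f) = \<tau> a"
        using lam[OF i] lam[OF i(1) K.C.comp_hom[OF f i(2)]] K.ar_comp[OF f i(2)]
          K.D.comp_assoc[OF K.ar_hom[OF f] K.ar_hom[OF i(2)] ka4[OF i(1)]] by simp
    qed
    then obtain h where h: "h \<in> hom C c d" "\<And>a. a \<in> Obj I' \<Longrightarrow> Comp C h (\<iota> a) = \<tau> a"
      using colimit_factor[OF col] by blast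
    \<comment> \<open>Here the convenient \<open>u\<close> is the identity of
      \<open>F i\<close>.\<close>
    have "Comp C h (\<iota> (ob F i)) = \<kappa> i" if i: "i \<in> Obj I" for i
      using h(2)[OF F.ob_in[OF i]] lam[OF i K.C.Ide_in[OF F.ob_in[OF i]]] K.ar_Ide[OF F.ob_in[OF i]]
        K.D.comp_ide_right[OF ka4[OF i]] by simp
    then show "\<exists>h \<in> hom C c d. \<forall>i \<in> Obj I. Comp C h ((\<lambda>i \<in> Obj I. \<iota> (ob F i)) i) = \<kappa> i"
      using h(1) by auto
  next
    fix d h h' assume hh: "h \<in> hom C c d" "h' \<in> hom C c d"
      and eq: "\<And>i. i \<in> Obj I \<Longrightarrow> Comp C h ((\<lambda>i \<in> Obj I. \<iota> (ob F i)) i) =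
        Comp C h' ((\<lambda>i \<in> Obj I. \<iota> (ob F i)) i)"
    show "h = h'"
    proof (rule colimit_hom_eqI[OF col hh])
      fix a assume a: "a \<in> Obj I'"
      \<comment> \<open>Every leg \<open>\<iota> a\<close> factors through a leg at some
        \<open>F i\<close>, so agreement on the image of \<open>F\<close> is enough.\<close>
      then obtain i u where i: "i \<in> Obj I" and u: "u \<in> hom I' a (ob F i)"
        using fin by (fastforce simp: final_functor_def connected_category_def comma_under_def)
      note as = K.D.comp_assoc[OF K.ar_hom[OF u] io(4)[OF F.ob_in[OF i]]]
      show "Comp C h (\<iota> a) = Comp C h' (\<iota> a)"
        using io(5)[OF u] as[OF hh(1)] as[OF hh(2)] eq[OF i] i by simp
    qed
  qed
qed


section \<open>Indiscrete categories\<close>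

text \<open>
  An injection \<open>e\<close> encodes the arrow from \<open>x\<close> to \<open>y\<close> as a point of the universe.
\<close>

definition indisc :: "('u \<times> 'u \<Rightarrow> 'u) \<Rightarrow> 'u set \<Rightarrow> ('u, 'u) cat" where
  "indisc e S =
     \<lparr>Obj = S, Arr = e ` (S \<times> S), Dom = (\<lambda>a. fst (inv e a)), Cod = (\<lambda>a. snd (inv e a)),
      Ide = (\<lambda>x. e (x, x)), Comp = (\<lambda>g f. e (fst (inv e f), snd (inv e g)))\<rparr>"

text \<open>\<open>q x y\<close> is the image of the unique arrow from \<open>x\<close> to
  \<open>y\<close>: a functor out of an indiscrete category is a family \<open>p\<close> of objects
  with a cocycle \<open>q\<close> of arrows.\<close>

definition indisc_map ::
  "('u \<times> 'u \<Rightarrow> 'u) \<Rightarrow> 'u set \<Rightarrow> ('u \<Rightarrow> 'o) \<Rightarrow> ('u \<Rightarrow> 'u \<Rightarrow> 'm) \<Rightarrow> ('u, 'u, 'o, 'm) fctr" where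
  "indisc_map e S p q =
     \<lparr>ob = restrict p S, ar = (\<lambda>a \<in> e ` (S \<times> S). q (fst (inv e a)) (snd (inv e a)))\<rparr>"

abbreviation indisc_fun ::
  "('u \<times> 'u \<Rightarrow> 'u) \<Rightarrow> 'u set \<Rightarrow> ('u \<Rightarrow> 'u) \<Rightarrow> ('u, 'u, 'u, 'u) fctr" where
  "indisc_fun e S \<phi> \<equiv> indisc_map e S \<phi> (\<lambda>x y. e (\<phi> x, \<phi> y))"

text \<open>When \<open>T\<close> acts functorially on the sets \<open>S\<close>, this is a
  set-valued functor on \<open>J\<close> followed by the formation of indiscrete categories.\<close>

definition indisc_diag ::
  "('j, 'k) cat \<Rightarrow> ('u \<times> 'u \<Rightarrow> 'u) \<Rightarrow> ('j \<Rightarrow> 'u set) \<Rightarrow> ('k \<Rightarrow> 'u \<Rightarrow> 'u) \<Rightarrow> ('j, 'k, 'u, 'u) diag" where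
  "indisc_diag J e S T =
     \<lparr>at_ob = (\<lambda>j. indisc e (S j)), at_ar = (\<lambda>f. indisc_fun e (S (Dom J f)) (T f))\<rparr>"

lemma indisc_map_cong:
  assumes "inj e" "\<And>x. x \<in> S \<Longrightarrow> p x = p' x" "\<And>x y. x \<in> S \<Longrightarrow> y \<in> S \<Longrightarrow> q x y = q' x y"
  shows "indisc_map e S p q = indisc_map e S p' q'"
  using assms by (auto simp: indisc_map_def restrict_def fun_eq_iff)

lemma indisc_map_eqD:
  assumes "inj e" "indisc_map e S p q = indisc_map e S p' q'"
  shows "x \<in> S \<Longrightarrow> p x = p' x" "x \<in> S \<Longrightarrow> y \<in> S \<Longrightarrow> q x y = q' x y"
proof -
  have "restrict p S = restrict p' S"
    "(\<lambda>a \<in> e ` (S \<times> S). q (fst (inv e a)) (snd (inv e a))) =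
     (\<lambda>a \<in> e ` (S \<times> S). q' (fst (inv e a)) (snd (inv e a)))"
    using assms(2) by (simp_all add: indisc_map_def)
  note 1 = this[THEN fun_cong]
  show "x \<in> S \<Longrightarrow> p x = p' x" using 1(1)[of x] by simp
  show "x \<in> S \<Longrightarrow> y \<in> S \<Longrightarrow> q x y = q' x y" using 1(2)[of "e (x, y)"] assms(1) by simp
qed

lemma comp_indisc_map:
  assumes "inj e" "\<And>x. x \<in> S \<Longrightarrow> \<phi> x \<in> T"
  shows "comp_functor (indisc e S) (indisc_map e T p q) (indisc_fun e S \<phi>) =
    indisc_map e S (\<lambda>x. p (\<phi> x)) (\<lambda>x y. q (\<phi> x) (\<phi> y))"
  using assms by (auto simp: comp_functor_def indisc_map_def indisc_def compose_def fun_eq_iff)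

lemma comp_functor_indisc_map:
  assumes "inj e"
  shows "comp_functor (indisc e S) G (indisc_map e S p q) =
    indisc_map e S (\<lambda>x. ob G (p x)) (\<lambda>x y. ar G (q x y))"
  using assms by (auto simp: comp_functor_def indisc_map_def indisc_def compose_def fun_eq_iff)

context
  fixes e :: "'u \<times> 'u \<Rightarrow> 'u"
  assumes e: "inj e"
begin

lemma category_indisc: "category (indisc e S)"
  by unfold_locales (auto simp: indisc_def hom_def e)

lemma indisc_homI: "x \<in> S \<Longrightarrow> y \<in> S \<Longrightarrow> e (x, y) \<in> hom (indisc e S) x y"
  by (auto simp: indisc_def hom_def e)

lemma indisc_hom_unique: "f \<in> hom (indisc e S) x y \<Longrightarrow> g \<in> hom (indisc e S) x y \<Longrightarrow> f = g"
  by (auto simp: indisc_def hom_def e)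

lemma indisc_Comp: "Comp (indisc e S) (e (y, z)) (e (x, y)) = e (x, z)"
  by (simp add: indisc_def e)

lemma cat_functor_indisc_map:
  assumes "category D" "\<And>x. x \<in> S \<Longrightarrow> p x \<in> Obj D"
    "\<And>x y. x \<in> S \<Longrightarrow> y \<in> S \<Longrightarrow> q x y \<in> hom D (p x) (p y)"
    "\<And>x. x \<in> S \<Longrightarrow> q x x = Ide D (p x)"
    "\<And>x y z. x \<in> S \<Longrightarrow> y \<in> S \<Longrightarrow> z \<in> S \<Longrightarrow> Comp D (q y z) (q x y) = q x z"
  shows "cat_functor (indisc e S) D (indisc_map e S p q)"
proof -
  interpret I: category "indisc e S" by (rule category_indisc)
  interpret D: category D by fact
  show ?thesis by unfold_locales (use assms e in \<open>auto simp: indisc_def indisc_map_def\<close>)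
qed

lemma cat_functor_indisc_fun:
  assumes "\<And>x. x \<in> S \<Longrightarrow> \<phi> x \<in> T"
  shows "cat_functor (indisc e S) (indisc e T) (indisc_fun e S \<phi>)"
  by (rule cat_functor_indisc_map[OF category_indisc])
    (use assms in \<open>auto simp: hom_def indisc_def e\<close>)

text \<open>Parallel arrows of an indiscrete category are equal, so naturality is automatic, and the
  reversed pair inverts each component.\<close>

lemma nat_iso_indisc:
  assumes "cat_functor C (indisc e S) F" "cat_functor C (indisc e S) G"
  shows "nat_iso C (indisc e S) F G (\<lambda>a \<in> Obj C. e (ob F a, ob G a))"
proof -
  interpret F: cat_functor C "indisc e S" F by fact
  interpret G: cat_functor C "indisc e S" G by fact
  have S: "ob F a \<in> S" "ob G a \<in> S" if "a \<in> Obj C" for a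
    using F.ob_in[OF that] G.ob_in[OF that] by (auto simp: indisc_def)
  let ?\<tau> = "\<lambda>a \<in> Obj C. e (ob F a, ob G a)"
  have t: "?\<tau> a \<in> hom (indisc e S) (ob F a) (ob G a)" if "a \<in> Obj C" for a
    using indisc_homI S that by simp
  have iso: "iso_arr (indisc e S) (e (x, y))" if "x \<in> S" "y \<in> S" for x y
    using that by (auto simp: iso_arr_def hom_def indisc_def e intro!: bexI[of _ "e (y, x)"])
  have "Comp (indisc e S) (ar G f) (?\<tau> (Dom C f)) = Comp (indisc e S) (?\<tau> (Cod C f)) (ar F f)"
    if "f \<in> Arr C" for f
    by (rule indisc_hom_unique)
      (rule F.D.comp_hom[OF t G.ar_in] F.D.comp_hom[OF F.ar_in t]; use that F.C.Dom_in F.C.Cod_in in simp)+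
  then show ?thesis
    using assms t iso S by (simp add: nat_iso_def nat_trans_def)
qed

text \<open>A constant functor back is an inverse up to isomorphism, with unit and counit from
  \<open>nat_iso_indisc\<close>; non-emptiness of \<open>S\<close> supplies the constant.\<close>

lemma equivalence_indisc_fun:
  assumes "\<And>x. x \<in> S \<Longrightarrow> \<phi> x \<in> T" "S \<noteq> {}"
  shows "equivalence_functor (indisc e S) (indisc e T) (indisc_fun e S \<phi>)"
proof -
  obtain x where x: "x \<in> S" using assms(2) by auto
  note F = cat_functor_indisc_fun[of S \<phi> T, OF assms(1)]
  have G: "cat_functor (indisc e T) (indisc e S) (indisc_fun e T (\<lambda>_. x))"
    by (rule cat_functor_indisc_fun) (rule x)
  show ?thesis
    unfolding equivalence_functor_def using F G
    by (blast intro: nat_iso_indisc cat_functor_id category_indisc cat_functor_comp)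
qed

section \<open>Diagrams of indiscrete categories from set-valued functors on
  \<open>J\<close>\<close>

context
  fixes J :: "('j, 'k) cat" and S :: "'j \<Rightarrow> 'u set" and T :: "'k \<Rightarrow> 'u \<Rightarrow> 'u"
  assumes J: "category J"
    and T_in: "\<And>f x. f \<in> Arr J \<Longrightarrow> x \<in> S (Dom J f) \<Longrightarrow> T f x \<in> S (Cod J f)"
    and T_Ide: "\<And>j x. j \<in> Obj J \<Longrightarrow> x \<in> S j \<Longrightarrow> T (Ide J j) x = x"
    and T_Comp: "\<And>f g x. \<lbrakk>f \<in> Arr J; g \<in> Arr J; Cod J f = Dom J g; x \<in> S (Dom J f)\<rbrakk>
      \<Longrightarrow> T (Comp J g f) x = T g (T f x)"
begin

interpretation J: category J by (rule J)

lemma diagram_indisc: "diagram J (indisc_diag J e S T)"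
proof (intro diagram.intro diagram_axioms.intro J)
  fix j assume j: "j \<in> Obj J"
  show "category (at_ob (indisc_diag J e S T) j)" by (simp add: indisc_diag_def category_indisc)
  have "indisc_fun e (S j) (T (Ide J j)) = indisc_map e (S j) (\<lambda>x. x) (\<lambda>x y. e (x, y))"
    by (rule indisc_map_cong[OF e]) (use T_Ide j in auto)
  also have "\<dots> = id_functor (indisc e (S j))"
    using e by (auto simp: indisc_map_def id_functor_def indisc_def fun_eq_iff)
  finally show "at_ar (indisc_diag J e S T) (Ide J j) = id_functor (at_ob (indisc_diag J e S T) j)"
    using homD(2)[OF J.Ide_in[OF j]] by (simp add: indisc_diag_def)
next
  fix f assume "f \<in> Arr J"
  then show "cat_functor (at_ob (indisc_diag J e S T) (Dom J f)) (at_ob (indisc_diag J e S T) (Cod J f))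
     (at_ar (indisc_diag J e S T) f)"
    using T_in by (simp add: indisc_diag_def cat_functor_indisc_fun)
next
  fix f g assume fg: "f \<in> Arr J" "g \<in> Arr J" "Cod J f = Dom J g"
  have "comp_functor (indisc e (S (Dom J f))) (indisc_fun e (S (Dom J g)) (T g))
      (indisc_fun e (S (Dom J f)) (T f)) =
    indisc_map e (S (Dom J f)) (\<lambda>x. T g (T f x)) (\<lambda>x y. e (T g (T f x), T g (T f y)))"
    by (rule comp_indisc_map[OF e]) (use fg T_in[of f] in auto)
  also have "\<dots> = indisc_fun e (S (Dom J f)) (T (Comp J g f))"
    by (rule indisc_map_cong[OF e]) (use fg T_Comp in auto)
  finally show "at_ar (indisc_diag J e S T) (Comp J g f) =
      comp_functor (at_ob (indisc_diag J e S T) (Dom J f)) (at_ar (indisc_diag J e S T) g)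
        (at_ar (indisc_diag J e S T) f)"
    using homD(2)[OF J.Comp_in[OF fg]] by (simp add: indisc_diag_def)
qed

text \<open>A levelwise cocycle that is natural over \<open>J\<close> is the same as a strict map
  out of the diagram; by this a pseudo-cone becomes a strict transformation.\<close>

lemma diag_trans_indisc_map:
  fixes X :: "('j, 'k, 'o, 'm) diag"
  assumes X: "diagram J X"
    and p: "\<And>j x. j \<in> Obj J \<Longrightarrow> x \<in> S j \<Longrightarrow> p j x \<in> Obj (at_ob X j)"
    and q: "\<And>j x y. j \<in> Obj J \<Longrightarrow> x \<in> S j \<Longrightarrow> y \<in> S j \<Longrightarrow> q j x y \<in> hom (at_ob X j) (p j x) (p j y)"
    and q_Ide: "\<And>j x. j \<in> Obj J \<Longrightarrow> x \<in> S j \<Longrightarrow> q j x x = Ide (at_ob X j) (p j x)"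
    and q_Comp: "\<And>j x y z. \<lbrakk>j \<in> Obj J; x \<in> S j; y \<in> S j; z \<in> S j\<rbrakk>
      \<Longrightarrow> Comp (at_ob X j) (q j y z) (q j x y) = q j x z"
    and p_nat: "\<And>f x. f \<in> Arr J \<Longrightarrow> x \<in> S (Dom J f) \<Longrightarrow>
      ob (at_ar X f) (p (Dom J f) x) = p (Cod J f) (T f x)"
    and q_nat: "\<And>f x y. f \<in> Arr J \<Longrightarrow> x \<in> S (Dom J f) \<Longrightarrow> y \<in> S (Dom J f) \<Longrightarrow>
      ar (at_ar X f) (q (Dom J f) x y) = q (Cod J f) (T f x) (T f y)"
  shows "diag_trans J (indisc_diag J e S T) X (\<lambda>j \<in> Obj J. indisc_map e (S j) (p j) (q j))"
  unfolding diag_trans_def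
proof (intro conjI ballI)
  interpret X: diagram J X by fact
  fix j assume j: "j \<in> Obj J"
  show "cat_functor (at_ob (indisc_diag J e S T) j) (at_ob X j)
      ((\<lambda>j \<in> Obj J. indisc_map e (S j) (p j) (q j)) j)"
    using j p q q_Ide q_Comp X.at_ob_category
    by (auto simp: indisc_diag_def intro!: cat_functor_indisc_map)
next
  fix f assume f: "f \<in> Arr J"
  show "comp_functor (at_ob (indisc_diag J e S T) (Dom J f)) (at_ar X f)
        ((\<lambda>j \<in> Obj J. indisc_map e (S j) (p j) (q j)) (Dom J f)) =
      comp_functor (at_ob (indisc_diag J e S T) (Dom J f))
        ((\<lambda>j \<in> Obj J. indisc_map e (S j) (p j) (q j)) (Cod J f)) (at_ar (indisc_diag J e S T) f)"
    using f J.Dom_in[OF f] J.Cod_in[OF f]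
    by (simp add: indisc_diag_def comp_indisc_map[OF e T_in[OF f]])
      (auto simp: comp_functor_indisc_map[OF e] p_nat q_nat intro!: indisc_map_cong[OF e])
qed (use diagram_indisc X in auto)

text \<open>The inclusion of a levelwise non-empty subfunctor \<open>R\<close> of \<open>S\<close>
  induces a levelwise trivial cofibration of indiscrete diagrams, and maps into a fibrant
  \<open>X\<close> extend along it. The conclusion speaks of \<open>p'\<close> and \<open>q'\<close>
  so that the encoding of functors disappears from later arguments.\<close>

lemma fibrant_extend_indisc:
  fixes X :: "('j, 'k, 'u, 'u) diag" and R :: "'j \<Rightarrow> 'u set"
  assumes fib: "injective_fibrant J X"
    and R: "\<And>j. j \<in> Obj J \<Longrightarrow> R j \<subseteq> S j" "\<And>j. j \<in> Obj J \<Longrightarrow> R j \<noteq> {}"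
    and R_in: "\<And>f x. f \<in> Arr J \<Longrightarrow> x \<in> R (Dom J f) \<Longrightarrow> T f x \<in> R (Cod J f)"
    and u: "diag_trans J (indisc_diag J e R T) X (\<lambda>j \<in> Obj J. indisc_map e (R j) (p j) (q j))"
  obtains p' q' where
    "\<And>j x. j \<in> Obj J \<Longrightarrow> x \<in> R j \<Longrightarrow> p' j x = p j x"
    "\<And>j x y. j \<in> Obj J \<Longrightarrow> x \<in> R j \<Longrightarrow> y \<in> R j \<Longrightarrow> q' j x y = q j x y"
    "\<And>j x y. j \<in> Obj J \<Longrightarrow> x \<in> S j \<Longrightarrow> y \<in> S j \<Longrightarrow> q' j x y \<in> hom (at_ob X j) (p' j x) (p' j y)"
    "\<And>j x. j \<in> Obj J \<Longrightarrow> x \<in> S j \<Longrightarrow> q' j x x = Ide (at_ob X j) (p' j x)"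
    "\<And>j x y z. \<lbrakk>j \<in> Obj J; x \<in> S j; y \<in> S j; z \<in> S j\<rbrakk>
      \<Longrightarrow> Comp (at_ob X j) (q' j y z) (q' j x y) = q' j x z"
    "\<And>f x. f \<in> Arr J \<Longrightarrow> x \<in> S (Dom J f) \<Longrightarrow>
      ob (at_ar X f) (p' (Dom J f) x) = p' (Cod J f) (T f x)"
    "\<And>f x y. f \<in> Arr J \<Longrightarrow> x \<in> S (Dom J f) \<Longrightarrow> y \<in> S (Dom J f) \<Longrightarrow>
      ar (at_ar X f) (q' (Dom J f) x y) = q' (Cod J f) (T f x) (T f y)"
proof -
  let ?A = "indisc_diag J e R T" and ?B = "indisc_diag J e S T"
  let ?i = "\<lambda>j \<in> Obj J. indisc_fun e (R j) (\<lambda>x. x)"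
  let ?u = "\<lambda>j \<in> Obj J. indisc_map e (R j) (p j) (q j)"
  have A: "diagram J ?A" and X: "diagram J X" using u by (auto simp: diag_trans_def)
  note B = diagram_indisc
  have dc: "Dom J f \<in> Obj J" "Cod J f \<in> Obj J" if "f \<in> Arr J" for f
    using that J.Dom_in J.Cod_in by auto
  have i: "diag_trans J ?A ?B ?i"
    unfolding diag_trans_def
  proof (intro conjI ballI)
    fix j assume j: "j \<in> Obj J"
    show "cat_functor (at_ob ?A j) (at_ob ?B j) (?i j)"
      using j R(1)[OF j] by (auto simp: indisc_diag_def intro!: cat_functor_indisc_fun)
  next
    fix f assume f: "f \<in> Arr J"
    have 1: "x \<in> S (Dom J f)" if "x \<in> R (Dom J f)" for x using that R(1) dc[OF f] by auto
    show "comp_functor (at_ob ?A (Dom J f)) (at_ar ?B f) (?i (Dom J f)) =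
        comp_functor (at_ob ?A (Dom J f)) (?i (Cod J f)) (at_ar ?A f)"
      using f dc[OF f] by (simp add: indisc_diag_def comp_indisc_map[OF e] 1 R_in)
  qed (use A B in auto)
  have "injective_weak_equivalence J ?A ?B ?i"
    using i R by (auto simp: injective_weak_equivalence_def indisc_diag_def
        intro!: equivalence_indisc_fun)
  moreover have "injective_cofibration J ?A ?B ?i"
    using i by (auto simp: injective_cofibration_def indisc_map_def indisc_diag_def indisc_def
        inj_on_def)
  moreover have v: "diag_trans J ?B (terminal_diag :: ('j, 'k, 'u, 'u) diag) (to_terminal J ?B)"
    by (rule diag_trans_to_terminal[OF B])
  \<comment> \<open>The lifting square commutes because maps into the terminal diagram are
    unique.\<close>
  moreover have "comp_trans J ?A (to_terminal J X) ?u =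
      comp_trans J ?A (to_terminal J ?B :: _ \<Rightarrow> (_, _, 'u, 'u) fctr) ?i"
    unfolding to_terminal_unique[OF diag_trans_comp[OF i v]]
    by (rule to_terminal_unique[OF diag_trans_comp[OF u diag_trans_to_terminal[OF X]]])
  ultimately have "\<exists>h. diag_trans J ?B X h \<and> comp_trans J ?A h ?i = ?u \<and>
      comp_trans J ?B (to_terminal J X) h = (to_terminal J ?B :: _ \<Rightarrow> (_, _, 'u, 'u) fctr)"
    using fib[unfolded injective_fibrant_def injective_fibration_def] u by blast
  then obtain h where h: "diag_trans J ?B X h" "comp_trans J ?A h ?i = ?u" by blast
  have hf: "cat_functor (indisc e (S j)) (at_ob X j) (h j)" if "j \<in> Obj J" for j
    using h(1) that by (auto simp: diag_trans_def indisc_diag_def)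
  have SO: "x \<in> Obj (indisc e (S j)) \<longleftrightarrow> x \<in> S j" for x j by (simp add: indisc_def)
  have SA: "x \<in> S j \<Longrightarrow> y \<in> S j \<Longrightarrow> e (x, y) \<in> Arr (indisc e (S j))" for x y j
    by (simp add: indisc_def)
  have hR: "indisc_map e (R j) (\<lambda>x. ob (h j) x) (\<lambda>x y. ar (h j) (e (x, y))) =
      indisc_map e (R j) (p j) (q j)" if "j \<in> Obj J" for j
    using fun_cong[OF h(2), of j] that
    by (simp add: comp_trans_def indisc_diag_def comp_functor_indisc_map[OF e])
  have nat: "comp_functor (indisc e (S (Dom J f))) (at_ar X f) (h (Dom J f)) =
      comp_functor (indisc e (S (Dom J f))) (h (Cod J f)) (indisc_fun e (S (Dom J f)) (T f))"
    if "f \<in> Arr J" for f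
    using h(1) that by (simp add: diag_trans_def indisc_diag_def)
  \<comment> \<open>The extended cocycle is read off the lift \<open>h\<close>: its values on points
    and on coded arrows.\<close>
  show thesis
  proof (rule that[of "\<lambda>j. ob (h j)" "\<lambda>j x y. ar (h j) (e (x, y))"])
    fix j x assume j: "j \<in> Obj J"
    show "ob (h j) x = p j x" if "x \<in> R j"
      by (rule indisc_map_eqD(1)[OF e hR[OF j] that])
    show "ar (h j) (e (x, y)) = q j x y" if "x \<in> R j" "y \<in> R j" for y
      by (rule indisc_map_eqD(2)[OF e hR[OF j] that])
    interpret h: cat_functor "indisc e (S j)" "at_ob X j" "h j" by (rule hf[OF j])
    show "ar (h j) (e (x, y)) \<in> hom (at_ob X j) (ob (h j) x) (ob (h j) y)"
      if "x \<in> S j" "y \<in> S j" for y by (rule h.ar_hom[OF indisc_homI[OF that]])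
    show "ar (h j) (e (x, x)) = Ide (at_ob X j) (ob (h j) x)" if "x \<in> S j"
      using h.ar_Ide[of x] that by (simp add: indisc_def)
    show "Comp (at_ob X j) (ar (h j) (e (y, z))) (ar (h j) (e (x, y))) = ar (h j) (e (x, z))"
      if "x \<in> S j" "y \<in> S j" "z \<in> S j" for y z
      using h.ar_comp[OF indisc_homI[OF that(1,2)] indisc_homI[OF that(2,3)]] indisc_Comp by simp
  next
    fix f x assume f: "f \<in> Arr J" "x \<in> S (Dom J f)"
    show "ob (at_ar X f) (ob (h (Dom J f)) x) = ob (h (Cod J f)) (T f x)"
      using arg_cong[OF nat[OF f(1)], of "\<lambda>F. ob F x"] f by (simp add: SO indisc_map_def)
    show "ar (at_ar X f) (ar (h (Dom J f)) (e (x, y))) = ar (h (Cod J f)) (e (T f x, T f y))"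
      if "y \<in> S (Dom J f)" for y
      using arg_cong[OF nat[OF f(1)], of "\<lambda>F. ar F (e (x, y))"] f that e
      by (simp add: SA indisc_map_def)
  qed
qed

end

end


section \<open>Strictification of cones in fibrant diagrams\<close>

text \<open>An infinite set is equipotent to its square. This lets the arrows of an indiscrete
  category live in the same universe as its objects.\<close>

lemma infinite_pairing:
  assumes "infinite (UNIV :: 'u set)"
  obtains e :: "'u \<times> 'u \<Rightarrow> 'u" where "inj e"
  using card_of_Times_same_infinite[OF assms] that
  by (auto simp: card_of_ordIso[symmetric] bij_betw_def)

text \<open>The hypotheses make \<open>c\<close> with \<open>\<theta>\<close> a pseudo-cone over
  \<open>X\<close>. In the conclusion \<open>d\<close> is a strict cone, that is, a pseudo-cone with
  identity comparisons, and \<open>t\<close> is an isomorphism of pseudo-cones from \<open>c\<close>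
  to \<open>d\<close>.\<close>

lemma fibrant_strictify_cone:
  fixes J :: "('u, 'u) cat" and X :: "('u, 'u, 'u, 'u) diag"
  assumes universe: "infinite (UNIV :: 'u set)"
    and J: "category J" and fib: "injective_fibrant J X"
    and c: "\<And>j. j \<in> Obj J \<Longrightarrow> c j \<in> Obj (at_ob X j)"
    and \<theta>: "\<And>f. f \<in> Arr J \<Longrightarrow>
      \<theta> f \<in> hom (at_ob X (Cod J f)) (ob (at_ar X f) (c (Dom J f))) (c (Cod J f))"
    and \<theta>_iso: "\<And>f. f \<in> Arr J \<Longrightarrow> iso_arr (at_ob X (Cod J f)) (\<theta> f)"
    and \<theta>_Ide: "\<And>j. j \<in> Obj J \<Longrightarrow> \<theta> (Ide J j) = Ide (at_ob X j) (c j)"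
    and \<theta>_Comp: "\<And>f g. \<lbrakk>f \<in> Arr J; g \<in> Arr J; Cod J f = Dom J g\<rbrakk> \<Longrightarrow>
      \<theta> (Comp J g f) = Comp (at_ob X (Cod J g)) (\<theta> g) (ar (at_ar X g) (\<theta> f))"
  obtains d t where "\<And>j. j \<in> Obj J \<Longrightarrow> d j \<in> Obj (at_ob X j)"
    "\<And>j. j \<in> Obj J \<Longrightarrow> t j \<in> hom (at_ob X j) (c j) (d j)"
    "\<And>j. j \<in> Obj J \<Longrightarrow> iso_arr (at_ob X j) (t j)"
    "\<And>f. f \<in> Arr J \<Longrightarrow> ob (at_ar X f) (d (Dom J f)) = d (Cod J f)"
    "\<And>f. f \<in> Arr J \<Longrightarrow> ar (at_ar X f) (t (Dom J f)) = Comp (at_ob X (Cod J f)) (t (Cod J f)) (\<theta> f)"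
proof -
  interpret J: category J by fact
  have X: "diagram J X" using fib by (simp add: injective_fibrant_def injective_fibration_def diag_trans_def)
  interpret X: diagram J X by (rule X)
  have dc: "Dom J f \<in> Obj J" "Cod J f \<in> Obj J" if "f \<in> Arr J" for f
    using that J.Dom_in J.Cod_in by auto
  have Id: "Ide J j \<in> Arr J" "Dom J (Ide J j) = j" "Cod J (Ide J j) = j" if "j \<in> Obj J" for j
    using J.Ide_in[OF that] by (auto simp: hom_def)
  have Co: "Comp J g f \<in> Arr J" "Dom J (Comp J g f) = Dom J f" "Cod J (Comp J g f) = Cod J g"
    if "f \<in> Arr J" "g \<in> Arr J" "Cod J f = Dom J g" for f g
    using J.Comp_in[OF that] by (auto simp: hom_def)
  \<comment> \<open>The object attached to an arrow \<open>f\<close> is \<open>c\<close> transported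
    along \<open>f\<close>; at the identity of \<open>j\<close> it is \<open>c j\<close>
    again.\<close>
  define P where "P f = ob (at_ar X f) (c (Dom J f))" for f
  have P: "P f \<in> Obj (at_ob X (Cod J f))" if "f \<in> Arr J" for f
    unfolding P_def by (rule cat_functor.ob_in[OF X.at_ar_functor[OF that] c[OF dc(1)[OF that]]])
  have P_Ide: "P (Ide J j) = c j" if "j \<in> Obj J" for j
    using that c Id by (simp add: P_def X.at_ar_Ide id_functor_def)
  have P_Comp: "ob (at_ar X g) (P f) = P (Comp J g f)"
    if "f \<in> Arr J" "g \<in> Arr J" "Cod J f = Dom J g" for f g
    using that c dc Co by (simp add: P_def X.at_ar_Comp)
  have "\<exists>g. g \<in> hom (at_ob X (Cod J f)) (c (Cod J f)) (P f) \<and>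
      Comp (at_ob X (Cod J f)) g (\<theta> f) = Ide (at_ob X (Cod J f)) (P f) \<and>
      Comp (at_ob X (Cod J f)) (\<theta> f) g = Ide (at_ob X (Cod J f)) (c (Cod J f))" if "f \<in> Arr J" for f
    using iso_arr_obtain[OF \<theta>_iso[OF that] \<theta>[OF that]] by (metis P_def)
  then obtain \<psi> where psi: "\<And>f. f \<in> Arr J \<Longrightarrow> \<psi> f \<in> hom (at_ob X (Cod J f)) (c (Cod J f)) (P f)"
    and psi_th: "\<And>f. f \<in> Arr J \<Longrightarrow> Comp (at_ob X (Cod J f)) (\<psi> f) (\<theta> f) = Ide (at_ob X (Cod J f)) (P f)"
    and th_psi: "\<And>f. f \<in> Arr J \<Longrightarrow>
      Comp (at_ob X (Cod J f)) (\<theta> f) (\<psi> f) = Ide (at_ob X (Cod J f)) (c (Cod J f))"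
    by metis
  note th = \<theta>[folded P_def]
  \<comment> \<open>\<open>P f\<close> and \<open>P g\<close> are compared through their common
    target: \<open>\<theta> f\<close> followed by the inverse \<open>\<psi> g\<close> of
    \<open>\<theta> g\<close>. In \<open>Q_Comp\<close> the middle pair cancels.\<close>
  define Q where "Q f g = Comp (at_ob X (Cod J f)) (\<psi> g) (\<theta> f)" for f g
  have Q: "Q f g \<in> hom (at_ob X (Cod J f)) (P f) (P g)"
    if "f \<in> Arr J" "g \<in> Arr J" "Cod J f = Cod J g" for f g
    unfolding Q_def using category.comp_hom[OF X.at_ob_category th[OF that(1)]] psi[OF that(2)] that dc
    by auto
  have Q_Comp: "Comp (at_ob X (Cod J f)) (Q g h) (Q f g) = Q f h"
    if "f \<in> Arr J" "g \<in> Arr J" "h \<in> Arr J" "Cod J f = Cod J g" "Cod J g = Cod J h" for f g h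
  proof -
    interpret D: category "at_ob X (Cod J f)" using X.at_ob_category dc that by auto
    note f = th[OF that(1)]
    have g: "\<theta> g \<in> hom (at_ob X (Cod J f)) (P g) (c (Cod J f))"
      "\<psi> g \<in> hom (at_ob X (Cod J f)) (c (Cod J f)) (P g)"
      "\<psi> h \<in> hom (at_ob X (Cod J f)) (c (Cod J f)) (P h)"
      using th psi that by metis+
    have "Comp (at_ob X (Cod J f)) (Q g h) (Q f g) =
      Comp (at_ob X (Cod J f)) (\<psi> h) (Comp (at_ob X (Cod J f)) (Comp (at_ob X (Cod J f)) (\<theta> g) (\<psi> g)) (\<theta> f))"
      using D.comp_assoc[OF D.comp_hom[OF f g(2)] g(1) g(3)] D.comp_assoc[OF f g(2) g(1)] that
      by (simp add: Q_def)
    also have "\<dots> = Q f h" using th_psi[OF that(2)] that(4) D.comp_ide_left[OF f] by (simp add: Q_def)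
    finally show ?thesis .
  qed
  \<comment> \<open>This is where the cocycle condition on \<open>\<theta>\<close> enters: both
    sides become \<open>\<theta> (Comp J k f)\<close> after composing with the isomorphism
    \<open>\<theta> (Comp J k g)\<close>, which \<open>\<psi>\<close> then cancels.\<close>
  have Q_nat: "ar (at_ar X k) (Q f g) = Q (Comp J k f) (Comp J k g)"
    if "f \<in> Arr J" "g \<in> Arr J" "k \<in> Arr J" "Cod J f = Cod J g" "Cod J f = Dom J k" for f g k
  proof -
    interpret K: cat_functor "at_ob X (Cod J f)" "at_ob X (Cod J k)" "at_ar X k"
      using X.at_ar_functor[OF that(3)] that by simp
    let ?Y = "at_ob X (Cod J k)"
    have kf: "Comp J k f \<in> Arr J" "Cod J (Comp J k f) = Cod J k"
      "Comp J k g \<in> Arr J" "Cod J (Comp J k g) = Cod J k" using Co that by auto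
    have k: "\<theta> k \<in> hom ?Y (ob (at_ar X k) (c (Cod J f))) (c (Cod J k))"
      using \<theta>[OF that(3)] that by simp
    have QQ: "ar (at_ar X k) (Q f g) \<in> hom ?Y (P (Comp J k f)) (P (Comp J k g))"
      using K.ar_hom[OF Q[OF that(1,2,4)]] P_Comp that by simp
    have g: "\<theta> g \<in> hom (at_ob X (Cod J f)) (P g) (c (Cod J f))"
      "\<psi> g \<in> hom (at_ob X (Cod J f)) (c (Cod J f)) (P g)" using th psi that by metis+
    have "Comp (at_ob X (Cod J f)) (\<theta> g) (Q f g) = \<theta> f"
      using K.C.comp_assoc[OF th[OF that(1)] g(2) g(1)] K.C.comp_ide_left[OF th[OF that(1)]]
        th_psi[OF that(2)] that(4) by (simp add: Q_def)
    then have "Comp ?Y (ar (at_ar X k) (\<theta> g)) (ar (at_ar X k) (Q f g)) = ar (at_ar X k) (\<theta> f)"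
      using K.ar_comp[OF Q[OF that(1,2,4)] g(1)] by simp
    then have 1: "Comp ?Y (\<theta> (Comp J k g)) (ar (at_ar X k) (Q f g)) = \<theta> (Comp J k f)"
      using K.D.comp_assoc[OF K.ar_hom[OF Q[OF that(1,2,4)]] K.ar_hom[OF g(1)] k]
        \<theta>_Comp[of f k] \<theta>_Comp[of g k] that by simp
    have kg: "\<theta> (Comp J k g) \<in> hom ?Y (P (Comp J k g)) (c (Cod J k))"
      "\<psi> (Comp J k g) \<in> hom ?Y (c (Cod J k)) (P (Comp J k g))"
      using th[OF kf(3)] psi[OF kf(3)] kf by simp_all
    have "Q (Comp J k f) (Comp J k g) =
        Comp ?Y (Comp ?Y (\<psi> (Comp J k g)) (\<theta> (Comp J k g))) (ar (at_ar X k) (Q f g))"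
      using K.D.comp_assoc[OF QQ kg(1) kg(2)] 1 kf by (simp add: Q_def)
    also have "\<dots> = ar (at_ar X k) (Q f g)"
      using psi_th[OF kf(3)] kf K.D.comp_ide_left[OF QQ] by simp
    finally show ?thesis by simp
  qed
  obtain e :: "'u \<times> 'u \<Rightarrow> 'u" where e: "inj e" using infinite_pairing[OF universe] .
  \<comment> \<open>Two distinct markers: arrows of \<open>J\<close>, themselves points of the
    universe, are coded with second component \<open>a\<close>, and the second component
    \<open>b\<close> keeps the new point \<open>z\<close> apart from all of them.\<close>
  obtain a b :: 'u where ab: "a \<noteq> b"
    using ex_new_if_finite[OF universe, of "{undefined}"] by auto
  define s where "s f = e (f, a)" for f
  define z where "z = e (a, b)"
  have s: "inv s (s f) = f" for f
    by (rule inv_f_f) (auto simp: inj_def s_def inj_eq[OF e])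
  have sz: "s f \<noteq> z" for f using ab by (auto simp: s_def z_def inj_eq[OF e])
  \<comment> \<open>Postcomposition with \<open>f\<close> on coded arrows. The point
    \<open>z\<close> is fixed by every transition map, so any strict map sends it to a strict
    cone.\<close>
  define T where "T f x = (if x = z then z else s (Comp J f (inv s x)))" for f x
  have T: "T f z = z" "T f (s g) = s (Comp J f g)" for f g using sz by (auto simp: T_def s)
  define R where "R j = s ` {f \<in> Arr J. Cod J f = j}" for j
  \<comment> \<open>The pseudo-cone as a strict transformation: functoriality at each level is the
    cocycle identity for \<open>Q\<close>, naturality is \<open>P_Comp\<close> and
    \<open>Q_nat\<close>.\<close>
  have u: "diag_trans J (indisc_diag J e R T) X
      (\<lambda>j \<in> Obj J. indisc_map e (R j) (\<lambda>x. P (inv s x)) (\<lambda>x y. Q (inv s x) (inv s y)))"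
  proof (rule diag_trans_indisc_map[OF e J])
    show "T f x \<in> R (Cod J f)" if "f \<in> Arr J" "x \<in> R (Dom J f)" for f x
      using that Co by (auto simp: R_def T)
    show "T (Ide J j) x = x" if "j \<in> Obj J" "x \<in> R j" for j x
      using that J.Ide_Comp by (auto simp: R_def T)
    show "T (Comp J g f) x = T g (T f x)"
      if "f \<in> Arr J" "g \<in> Arr J" "Cod J f = Dom J g" "x \<in> R (Dom J f)" for f g x
      using that J.Comp_assoc by (auto simp: R_def T)
    show "Q (inv s x) (inv s x) = Ide (at_ob X j) (P (inv s x))" if "j \<in> Obj J" "x \<in> R j" for j x
      using that psi_th by (auto simp: R_def s Q_def)
    show "Q (inv s x) (inv s y) \<in> hom (at_ob X j) (P (inv s x)) (P (inv s y))"
      if "j \<in> Obj J" "x \<in> R j" "y \<in> R j" for j x y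
      using that Q[of "inv s x" "inv s y"] by (auto simp: R_def s)
    show "Comp (at_ob X j) (Q (inv s y) (inv s z)) (Q (inv s x) (inv s y)) = Q (inv s x) (inv s z)"
      if "j \<in> Obj J" "x \<in> R j" "y \<in> R j" "z \<in> R j" for j x y z
      using that Q_Comp[of "inv s x" "inv s y" "inv s z"] by (auto simp: R_def s)
  qed (use X in \<open>auto simp: R_def s T P P_Comp Q_nat\<close>)
  define S where "S j = insert z (R j)" for j
  have T_R: "T f x \<in> R (Cod J f)" if "f \<in> Arr J" "x \<in> R (Dom J f)" for f x
    using that Co by (auto simp: R_def T)
  then have T_S: "T f x \<in> S (Cod J f)" if "f \<in> Arr J" "x \<in> S (Dom J f)" for f x
    using that by (auto simp: S_def T)
  have T_Ide: "T (Ide J j) x = x" if "j \<in> Obj J" "x \<in> S j" for j x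
    using that J.Ide_Comp by (auto simp: R_def S_def T)
  have T_Comp: "T (Comp J g f) x = T g (T f x)"
    if "f \<in> Arr J" "g \<in> Arr J" "Cod J f = Dom J g" "x \<in> S (Dom J f)" for f g x
    using that J.Comp_assoc by (auto simp: R_def S_def T)
  have R_S: "R j \<subseteq> S j" for j by (auto simp: S_def)
  \<comment> \<open>The coded identity of \<open>j\<close> lies in \<open>R j\<close>; non-emptiness
    makes the inclusion into \<open>S j\<close> an equivalence.\<close>
  have R_ne: "R j \<noteq> {}" if "j \<in> Obj J" for j using Id[OF that] by (auto simp: R_def)
  obtain p q where p: "\<And>j x. j \<in> Obj J \<Longrightarrow> x \<in> R j \<Longrightarrow> p j x = P (inv s x)"
    and q: "\<And>j x y. j \<in> Obj J \<Longrightarrow> x \<in> R j \<Longrightarrow> y \<in> R j \<Longrightarrow> q j x y = Q (inv s x) (inv s y)"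
    and q_in: "\<And>j x y. j \<in> Obj J \<Longrightarrow> x \<in> S j \<Longrightarrow> y \<in> S j \<Longrightarrow> q j x y \<in> hom (at_ob X j) (p j x) (p j y)"
    and q_Ide: "\<And>j x. j \<in> Obj J \<Longrightarrow> x \<in> S j \<Longrightarrow> q j x x = Ide (at_ob X j) (p j x)"
    and q_Comp: "\<And>j x y z. \<lbrakk>j \<in> Obj J; x \<in> S j; y \<in> S j; z \<in> S j\<rbrakk>
      \<Longrightarrow> Comp (at_ob X j) (q j y z) (q j x y) = q j x z"
    and p_nat: "\<And>f x. f \<in> Arr J \<Longrightarrow> x \<in> S (Dom J f) \<Longrightarrow>
      ob (at_ar X f) (p (Dom J f) x) = p (Cod J f) (T f x)"
    and q_nat: "\<And>f x y. f \<in> Arr J \<Longrightarrow> x \<in> S (Dom J f) \<Longrightarrow> y \<in> S (Dom J f) \<Longrightarrow>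
      ar (at_ar X f) (q (Dom J f) x y) = q (Cod J f) (T f x) (T f y)"
    using fibrant_extend_indisc[OF e J T_S T_Ide T_Comp fib R_S R_ne T_R u] by blast
  have sR: "s f \<in> R (Cod J f)" if "f \<in> Arr J" for f using that by (simp add: R_def)
  have idR: "s (Ide J j) \<in> R j" if "j \<in> Obj J" for j using sR[OF Id(1)[OF that]] Id(3)[OF that] by simp
  have RS: "x \<in> R j \<Longrightarrow> x \<in> S j" and zS: "z \<in> S j" for x j by (auto simp: S_def)
  \<comment> \<open>\<open>d j\<close> is the image of \<open>z\<close>, and \<open>t j\<close> is
    the image of the arrow to \<open>z\<close> from the coded identity of \<open>j\<close>, which
    itself goes to \<open>c j\<close>. It is invertible because all arrows of an indiscrete category
    are.\<close>
  show thesis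
  proof (rule that[of "\<lambda>j. p j z" "\<lambda>j. q j (s (Ide J j)) z"])
    fix j assume j: "j \<in> Obj J"
    interpret D: category "at_ob X j" by (rule X.at_ob_category[OF j])
    have pj: "p j (s (Ide J j)) = c j" using p[OF j idR[OF j]] P_Ide[OF j] by (simp add: s)
    note iS = RS[OF idR[OF j]]
    show t: "q j (s (Ide J j)) z \<in> hom (at_ob X j) (c j) (p j z)"
      using q_in[OF j iS zS] pj by simp
    then show "p j z \<in> Obj (at_ob X j)" by (rule D.hom_Obj)
    show "iso_arr (at_ob X j) (q j (s (Ide J j)) z)"
      using q_in[OF j iS zS] q_in[OF j zS iS] q_Comp[OF j iS zS iS] q_Comp[OF j zS iS zS]
        q_Ide[OF j iS] q_Ide[OF j zS] by (auto simp: iso_arr_def hom_def)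
  next
    fix f assume f: "f \<in> Arr J"
    show "ob (at_ar X f) (p (Dom J f) z) = p (Cod J f) z" using p_nat[OF f zS] by (simp add: T)
    let ?k = "Cod J f"
    have k: "?k \<in> Obj J" using dc f by auto
    interpret D: category "at_ob X ?k" by (rule X.at_ob_category[OF k])
    \<comment> \<open>As \<open>\<psi>\<close> is trivial at identities, \<open>\<theta> f\<close>
      is itself a value of the cocycle: on the arrow from the code of \<open>f\<close> to that of
      the identity of its codomain.\<close>
    have 1: "\<psi> (Ide J ?k) = Ide (at_ob X ?k) (c ?k)"
      using th_psi[OF Id(1)[OF k]] \<theta>_Ide[OF k] D.comp_ide_left[of "\<psi> (Ide J ?k)" "c ?k" "c ?k"]
        psi[OF Id(1)[OF k]] P_Ide[OF k] Id[OF k] by simp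
    have "q ?k (s f) (s (Ide J ?k)) = \<theta> f"
      using q[OF k sR[OF f] idR[OF k]] D.comp_ide_left[OF th[OF f]] by (simp add: s Q_def 1)
    \<comment> \<open>The transition map of \<open>f\<close> takes the coded identity to
      \<open>s f\<close>, so the claim is the cocycle identity from \<open>s f\<close> through the
      coded identity of the codomain to \<open>z\<close>.\<close>
    moreover have "ar (at_ar X f) (q (Dom J f) (s (Ide J (Dom J f))) z) = q ?k (s f) z"
      using q_nat[OF f RS[OF idR[OF dc(1)[OF f]]] zS] J.Comp_Ide[OF f] by (simp add: T)
    ultimately show "ar (at_ar X f) (q (Dom J f) (s (Ide J (Dom J f))) z) =
        Comp (at_ob X ?k) (q ?k (s (Ide J ?k)) z) (\<theta> f)"
      using q_Comp[OF k RS[OF sR[OF f]] RS[OF idR[OF k]] zS] by simp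
  qed
qed


section \<open>Colimits of a weighted cone\<close>

text \<open>The comparison isomorphisms form a pseudo-cone because both sides of each law agree on
  the legs of a colimit. The isomorphisms \<open>t\<close> of the strictification then carry the
  colimit cocones over to the strict cone.\<close>

lemma strict_colimit_cone:
  fixes J :: "('u, 'u) cat" and W X :: "('u, 'u, 'u, 'u) diag"
  assumes universe: "infinite (UNIV :: 'u set)"
    and fib: "injective_fibrant J X"
    and colims: "\<And>j. j \<in> Obj J \<Longrightarrow> admits_colimits (at_ob W j) (at_ob X j)"
    and preserves: "\<And>f j k. f \<in> hom J j k \<Longrightarrow>
      preserves_colimits (at_ob W j) (at_ob X j) (at_ob X k) (at_ar X f)"
    and final: "\<And>f j k. f \<in> hom J j k \<Longrightarrow> final_functor (at_ob W j) (at_ob W k) (at_ar W f)"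
    and \<alpha>: "diag_trans J W X \<alpha>"
  obtains d \<iota> where
    "\<And>j. j \<in> Obj J \<Longrightarrow> is_colimit (at_ob W j) (at_ob X j) (\<alpha> j) (d j) (\<iota> j)"
    "\<And>f. f \<in> Arr J \<Longrightarrow> ob (at_ar X f) (d (Dom J f)) = d (Cod J f)"
    "\<And>f w. f \<in> Arr J \<Longrightarrow> w \<in> Obj (at_ob W (Dom J f)) \<Longrightarrow>
      ar (at_ar X f) (\<iota> (Dom J f) w) = \<iota> (Cod J f) (ob (at_ar W f) w)"
proof -
  interpret W: diagram J W using \<alpha> by (simp add: diag_trans_def)
  interpret X: diagram J X using \<alpha> by (simp add: diag_trans_def)
  have dc: "Dom J f \<in> Obj J" "Cod J f \<in> Obj J" if "f \<in> Arr J" for f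
    using that W.J.Dom_in W.J.Cod_in by auto
  have W_in: "ob (at_ar W f) w \<in> Obj (at_ob W (Cod J f))"
    if "f \<in> Arr J" "w \<in> Obj (at_ob W (Dom J f))" for f w
    using cat_functor.ob_in[OF W.at_ar_functor[OF that(1)] that(2)] .
  have af: "cat_functor (at_ob W j) (at_ob X j) (\<alpha> j)" if "j \<in> Obj J" for j
    using \<alpha> that by (simp add: diag_trans_def)
  have "\<exists>c \<kappa>. is_colimit (at_ob W j) (at_ob X j) (\<alpha> j) c \<kappa>" if "j \<in> Obj J" for j
    using colims[OF that] af[OF that] by (simp add: admits_colimits_def)
  then obtain c \<kappa> where ck: "\<And>j. j \<in> Obj J \<Longrightarrow> is_colimit (at_ob W j) (at_ob X j) (\<alpha> j) (c j) (\<kappa> j)"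
    by metis
  note kap = coconeD[OF colimit_cocone[OF ck]]
  have kin: "ar (at_ar X f) (\<kappa> (Dom J f) w)
      \<in> hom (at_ob X (Cod J f)) (ob (at_ar X f) (ob (\<alpha> (Dom J f)) w)) (ob (at_ar X f) (c (Dom J f)))"
    if "f \<in> Arr J" "w \<in> Obj (at_ob W (Dom J f))" for f w
    using cat_functor.ar_hom[OF X.at_ar_functor kap(4)] that dc by blast
  have image: "is_colimit (at_ob W (Dom J f)) (at_ob X (Cod J f))
      (comp_functor (at_ob W (Dom J f)) (at_ar X f) (\<alpha> (Dom J f))) (ob (at_ar X f) (c (Dom J f)))
      (\<lambda>w \<in> Obj (at_ob W (Dom J f)). ar (at_ar X f) (\<kappa> (Dom J f) w))" if "f \<in> Arr J" for f
    using preserves[OF Arr_hom[OF that]] af[OF dc(1)[OF that]] ck[OF dc(1)[OF that]]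
    unfolding preserves_colimits_def by blast
  \<comment> \<open>Naturality of \<open>\<alpha>\<close> rewrites the restricted diagram as the one
    in \<open>image\<close>, so the same diagram now has two colimits.\<close>
  have restr: "is_colimit (at_ob W (Dom J f)) (at_ob X (Cod J f))
      (comp_functor (at_ob W (Dom J f)) (at_ar X f) (\<alpha> (Dom J f))) (c (Cod J f))
      (\<lambda>w \<in> Obj (at_ob W (Dom J f)). \<kappa> (Cod J f) (ob (at_ar W f) w))" if "f \<in> Arr J" for f
    using colimit_final[OF final[OF Arr_hom[OF that]] ck[OF dc(2)[OF that]]] \<alpha> that
    by (simp add: diag_trans_def)
  have "\<exists>t. t \<in> hom (at_ob X (Cod J f)) (ob (at_ar X f) (c (Dom J f))) (c (Cod J f)) \<and>
      iso_arr (at_ob X (Cod J f)) t \<and>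
      (\<forall>w \<in> Obj (at_ob W (Dom J f)). Comp (at_ob X (Cod J f)) t (ar (at_ar X f) (\<kappa> (Dom J f) w)) =
        \<kappa> (Cod J f) (ob (at_ar W f) w))" if "f \<in> Arr J" for f
    by (rule colimit_unique_iso[OF image[OF that] restr[OF that]]) auto
  then obtain \<theta> where th: "\<And>f. f \<in> Arr J \<Longrightarrow>
      \<theta> f \<in> hom (at_ob X (Cod J f)) (ob (at_ar X f) (c (Dom J f))) (c (Cod J f))"
    and th_iso: "\<And>f. f \<in> Arr J \<Longrightarrow> iso_arr (at_ob X (Cod J f)) (\<theta> f)"
    and th_kap: "\<And>f w. f \<in> Arr J \<Longrightarrow> w \<in> Obj (at_ob W (Dom J f)) \<Longrightarrow>
      Comp (at_ob X (Cod J f)) (\<theta> f) (ar (at_ar X f) (\<kappa> (Dom J f) w)) = \<kappa> (Cod J f) (ob (at_ar W f) w)"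
    by metis
  have th_Ide: "\<theta> (Ide J j) = Ide (at_ob X j) (c j)" if j: "j \<in> Obj J" for j
  proof (rule colimit_hom_eqI[OF ck[OF j]])
    interpret D: category "at_ob X j" by (rule X.at_ob_category[OF j])
    note I = homD[OF W.J.Ide_in[OF j]]
    show "Ide (at_ob X j) (c j) \<in> hom (at_ob X j) (c j) (c j)" by (rule D.Ide_in[OF kap(2)[OF j]])
    show "\<theta> (Ide J j) \<in> hom (at_ob X j) (c j) (c j)"
      using th[OF I(1)] I kap(2)[OF j] by (simp add: X.at_ar_Ide[OF j] id_functor_def)
    fix w assume w: "w \<in> Obj (at_ob W j)"
    show "Comp (at_ob X j) (\<theta> (Ide J j)) (\<kappa> j w) = Comp (at_ob X j) (Ide (at_ob X j) (c j)) (\<kappa> j w)"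
      using th_kap[OF I(1), of w] I w homD(1)[OF kap(4)[OF j w]] D.comp_ide_left[OF kap(4)[OF j w]]
      by (simp add: X.at_ar_Ide[OF j] W.at_ar_Ide[OF j] id_functor_def)
  qed
  have th_Comp: "\<theta> (Comp J g f) = Comp (at_ob X (Cod J g)) (\<theta> g) (ar (at_ar X g) (\<theta> f))"
    if f: "f \<in> Arr J" and g: "g \<in> Arr J" and fg: "Cod J f = Dom J g" for f g
  proof -
    note gf = homD[OF W.J.Comp_in[OF f g fg]]
    interpret G: cat_functor "at_ob X (Dom J g)" "at_ob X (Cod J g)" "at_ar X g"
      by (rule X.at_ar_functor[OF g])
    have c: "c (Dom J f) \<in> Obj (at_ob X (Dom J f))" by (rule kap(2)[OF dc(1)[OF f]])
    have tf: "ar (at_ar X g) (\<theta> f) \<in> hom (at_ob X (Cod J g))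
        (ob (at_ar X (Comp J g f)) (c (Dom J f))) (ob (at_ar X g) (c (Dom J g)))"
      using G.ar_hom th[OF f] c by (simp add: fg X.at_ar_Comp[OF f g fg])
    \<comment> \<open>Both sides start at the image of \<open>c\<close> under the composite
      transition functor. Preservation along \<open>Comp J g f\<close> makes this a colimit, so they
      may be compared on its legs.\<close>
    show ?thesis
    proof (rule colimit_hom_eqI[OF image[OF gf(1), unfolded gf(2,3)]])
      show "\<theta> (Comp J g f) \<in> hom (at_ob X (Cod J g)) (ob (at_ar X (Comp J g f)) (c (Dom J f))) (c (Cod J g))"
        using th[OF gf(1)] gf by simp
      show "Comp (at_ob X (Cod J g)) (\<theta> g) (ar (at_ar X g) (\<theta> f))
          \<in> hom (at_ob X (Cod J g)) (ob (at_ar X (Comp J g f)) (c (Dom J f))) (c (Cod J g))"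
        by (rule G.D.comp_hom[OF tf th[OF g]])
      fix w assume w: "w \<in> Obj (at_ob W (Dom J f))"
      have k: "\<kappa> (Dom J f) w \<in> Arr (at_ob X (Dom J f))" by (rule homD(1)[OF kap(4)[OF dc(1)[OF f] w]])
      note kf = kin[OF f w, unfolded fg]
      have "Comp (at_ob X (Cod J g)) (Comp (at_ob X (Cod J g)) (\<theta> g) (ar (at_ar X g) (\<theta> f)))
            (ar (at_ar X (Comp J g f)) (\<kappa> (Dom J f) w)) =
          Comp (at_ob X (Cod J g)) (\<theta> g) (Comp (at_ob X (Cod J g)) (ar (at_ar X g) (\<theta> f))
            (ar (at_ar X g) (ar (at_ar X f) (\<kappa> (Dom J f) w))))"
        using G.D.comp_assoc[OF G.ar_hom[OF kf] G.ar_hom[OF th[OF f, unfolded fg]] th[OF g]] k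
        by (simp add: X.at_ar_Comp[OF f g fg])
      also have "\<dots> = Comp (at_ob X (Cod J g)) (\<theta> g) (ar (at_ar X g) (\<kappa> (Dom J g) (ob (at_ar W f) w)))"
        using G.ar_comp[OF kf th[OF f, unfolded fg]] th_kap[OF f w] fg by simp
      also have "\<dots> = \<kappa> (Cod J g) (ob (at_ar W (Comp J g f)) w)"
        using th_kap[OF g, of "ob (at_ar W f) w"] W_in[OF f w] w fg by (simp add: W.at_ar_Comp[OF f g fg])
      also have "\<dots> = Comp (at_ob X (Cod J g)) (\<theta> (Comp J g f))
          (ar (at_ar X (Comp J g f)) (\<kappa> (Dom J f) w))"
        using th_kap[OF gf(1), of w] gf w by simp
      finally show "Comp (at_ob X (Cod J g)) (\<theta> (Comp J g f))
           ((\<lambda>w \<in> Obj (at_ob W (Dom J f)). ar (at_ar X (Comp J g f)) (\<kappa> (Dom J f) w)) w) =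
         Comp (at_ob X (Cod J g)) (Comp (at_ob X (Cod J g)) (\<theta> g) (ar (at_ar X g) (\<theta> f)))
           ((\<lambda>w \<in> Obj (at_ob W (Dom J f)). ar (at_ar X (Comp J g f)) (\<kappa> (Dom J f) w)) w)"
        using w by simp
    qed
  qed
  obtain d t where d: "\<And>j. j \<in> Obj J \<Longrightarrow> d j \<in> Obj (at_ob X j)"
    and t: "\<And>j. j \<in> Obj J \<Longrightarrow> t j \<in> hom (at_ob X j) (c j) (d j)"
    and t_iso: "\<And>j. j \<in> Obj J \<Longrightarrow> iso_arr (at_ob X j) (t j)"
    and d_nat: "\<And>f. f \<in> Arr J \<Longrightarrow> ob (at_ar X f) (d (Dom J f)) = d (Cod J f)"
    and t_nat: "\<And>f. f \<in> Arr J \<Longrightarrow>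
      ar (at_ar X f) (t (Dom J f)) = Comp (at_ob X (Cod J f)) (t (Cod J f)) (\<theta> f)"
    using fibrant_strictify_cone[OF universe W.J.category_axioms fib kap(2) th th_iso th_Ide th_Comp]
    by blast
  show thesis
  proof (rule that[of d "\<lambda>j. \<lambda>w \<in> Obj (at_ob W j). Comp (at_ob X j) (t j) (\<kappa> j w)"])
    show "is_colimit (at_ob W j) (at_ob X j) (\<alpha> j) (d j)
        (\<lambda>w \<in> Obj (at_ob W j). Comp (at_ob X j) (t j) (\<kappa> j w))" if "j \<in> Obj J" for j
      by (rule colimit_iso[OF ck t t_iso]) fact+
    show "ob (at_ar X f) (d (Dom J f)) = d (Cod J f)" if "f \<in> Arr J" for f by (rule d_nat[OF that])
    fix f w assume f: "f \<in> Arr J" and w: "w \<in> Obj (at_ob W (Dom J f))"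
    interpret F: cat_functor "at_ob X (Dom J f)" "at_ob X (Cod J f)" "at_ar X f"
      by (rule X.at_ar_functor[OF f])
    \<comment> \<open>With \<open>j\<close> and \<open>k\<close> the domain and codomain of
      \<open>f\<close>, the chain is \<open>X_f(t_j \<kappa>_j w) = (t_k \<theta>_f) X_f(\<kappa>_j
      w) = t_k \<kappa>_k(W_f w)\<close>, by \<open>t_nat\<close> and then
      \<open>th_kap\<close>.\<close>
    show "ar (at_ar X f) ((\<lambda>w \<in> Obj (at_ob W (Dom J f)).
          Comp (at_ob X (Dom J f)) (t (Dom J f)) (\<kappa> (Dom J f) w)) w) =
        (\<lambda>w \<in> Obj (at_ob W (Cod J f)). Comp (at_ob X (Cod J f)) (t (Cod J f)) (\<kappa> (Cod J f) w))
          (ob (at_ar W f) w)"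
      using w W_in[OF f w] F.ar_comp[OF kap(4)[OF dc(1)[OF f] w] t[OF dc(1)[OF f]]] t_nat[OF f]
        F.D.comp_assoc[OF kin[OF f w] th[OF f] t[OF dc(2)[OF f]]] th_kap[OF f w] by simp
  qed
qed


section \<open>Cones as natural transformations from the terminal weight\<close>

lemma terminal_simps:
  "Obj (terminal_category :: ('o, 'm) cat) = {undefined}"
  "Arr (terminal_category :: ('o, 'm) cat) = {undefined}"
  "Dom (terminal_category :: ('o, 'm) cat) f = undefined"
  "Cod (terminal_category :: ('o, 'm) cat) f = undefined"
  "Ide (terminal_category :: ('o, 'm) cat) a = undefined"
  "at_ob (terminal_diag :: ('j, 'k, 'o, 'm) diag) j = terminal_category"
  "at_ar (terminal_diag :: ('j, 'k, 'o, 'm) diag) k = id_functor terminal_category"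
  by (simp_all add: terminal_category_def terminal_diag_def)

lemma terminal_coneD:
  assumes "diag_trans J terminal_diag X \<beta>" "j \<in> Obj J"
  shows "ob (\<beta> j) undefined \<in> Obj (at_ob X j)"
    "ar (\<beta> j) undefined = Ide (at_ob X j) (ob (\<beta> j) undefined)"
proof -
  interpret b: cat_functor terminal_category "at_ob X j" "\<beta> j"
    using assms by (simp add: diag_trans_def terminal_simps)
  show "ob (\<beta> j) undefined \<in> Obj (at_ob X j)"
    "ar (\<beta> j) undefined = Ide (at_ob X j) (ob (\<beta> j) undefined)"
    using b.ob_in[of undefined] b.ar_Ide[of undefined] by (simp_all add: terminal_simps)
qed

lemma diag_trans_strict_cone:
  fixes X :: "('j, 'k, 'p, 'n) diag"
  assumes X: "diagram J X"
    and d: "\<And>j. j \<in> Obj J \<Longrightarrow> d j \<in> Obj (at_ob X j)"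
    and d_nat: "\<And>f. f \<in> Arr J \<Longrightarrow> ob (at_ar X f) (d (Dom J f)) = d (Cod J f)"
  shows "diag_trans J (terminal_diag :: ('j, 'k, 'o, 'm) diag) X
    (\<lambda>j \<in> Obj J. const_functor terminal_category (at_ob X j) (d j))"
  unfolding diag_trans_def
proof (intro conjI ballI)
  interpret X: diagram J X by (rule X)
  show "diagram J (terminal_diag :: ('j, 'k, 'o, 'm) diag)"
    by (rule diagram_terminal[OF X.J.category_axioms])
  fix j assume j: "j \<in> Obj J"
  then show "cat_functor (at_ob terminal_diag j) (at_ob X j)
      ((\<lambda>j \<in> Obj J. const_functor terminal_category (at_ob X j) (d j)) j)"
    by (simp add: terminal_simps cat_functor_const[OF category_terminal X.at_ob_category d])
next
  interpret X: diagram J X by (rule X)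
  fix f assume f: "f \<in> Arr J"
  interpret F: cat_functor "at_ob X (Dom J f)" "at_ob X (Cod J f)" "at_ar X f"
    by (rule X.at_ar_functor[OF f])
  note dc = X.J.Dom_in[OF f] X.J.Cod_in[OF f]
  show "comp_functor (at_ob terminal_diag (Dom J f)) (at_ar X f)
       ((\<lambda>j \<in> Obj J. const_functor terminal_category (at_ob X j) (d j)) (Dom J f)) =
     comp_functor (at_ob terminal_diag (Dom J f))
       ((\<lambda>j \<in> Obj J. const_functor terminal_category (at_ob X j) (d j)) (Cod J f)) (at_ar terminal_diag f)"
    using dc F.ar_Ide[OF d[OF dc(1)]] d_nat[OF f]
    by (auto simp: comp_functor_def terminal_simps const_functor_def id_functor_def compose_def fun_eq_iff)
qed (use X in auto)

text \<open>\<open>undefined\<close> is the only object of the terminal category, so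
  \<open>\<nu> j\<close> carries a single arrow, and the square over the only arrow holds by the
  identity laws.\<close>

lemma modification_terminal:
  fixes \<nu> :: "'j \<Rightarrow> 'o \<Rightarrow> 'm" and X :: "('j, 'k, 'p, 'm) diag"
  assumes \<beta>: "diag_trans J (terminal_diag :: ('j, 'k, 'o, 'n) diag) X \<beta>"
    and \<gamma>: "diag_trans J (terminal_diag :: ('j, 'k, 'o, 'n) diag) X \<gamma>"
  shows "modification J terminal_diag X \<beta> \<gamma> \<nu> \<longleftrightarrow>
    \<nu> \<in> extensional (Obj J) \<and>
    (\<forall>j \<in> Obj J. \<nu> j \<in> extensional {undefined} \<and>
      \<nu> j undefined \<in> hom (at_ob X j) (ob (\<beta> j) undefined) (ob (\<gamma> j) undefined)) \<and>
    (\<forall>f \<in> Arr J. ar (at_ar X f) (\<nu> (Dom J f) undefined) = \<nu> (Cod J f) undefined)"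
proof -
  interpret X: diagram J X using \<beta> by (simp add: diag_trans_def)
  have "nat_trans terminal_category (at_ob X j) (\<beta> j) (\<gamma> j) (\<nu> j) \<longleftrightarrow>
      \<nu> j \<in> extensional {undefined} \<and>
      \<nu> j undefined \<in> hom (at_ob X j) (ob (\<beta> j) undefined) (ob (\<gamma> j) undefined)"
    if j: "j \<in> Obj J" for j
  proof -
    interpret D: category "at_ob X j" by (rule X.at_ob_category[OF j])
    have "cat_functor terminal_category (at_ob X j) (\<beta> j)" "cat_functor terminal_category (at_ob X j) (\<gamma> j)"
      using \<beta> \<gamma> j by (auto simp: diag_trans_def terminal_simps)
    then show ?thesis
      using terminal_coneD[OF \<beta> j] terminal_coneD[OF \<gamma> j] D.comp_ide_left D.comp_ide_right
      by (auto simp: nat_trans_def terminal_simps)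
  qed
  then show ?thesis using \<beta> \<gamma> by (auto simp: modification_def terminal_simps id_functor_def)
qed

section \<open>Values of \<open>Delta\<close> and modifications into them\<close>

lemma ob_Delta:
  assumes "diag_trans J terminal_diag X \<beta>"
  shows "ob (Delta J W X) \<beta> =
    (\<lambda>j \<in> Obj J. const_functor (at_ob W j) (at_ob X j) (ob (\<beta> j) undefined))"
  using assms terminal_coneD[OF assms]
  by (auto simp: Delta_def precomp_functor_def diag_hom_def comp_trans_def to_terminal_def
      comp_functor_def const_functor_def compose_def terminal_simps fun_eq_iff)

lemma ar_Delta:
  assumes "modification J terminal_diag X \<beta> \<gamma> \<nu>"
  shows "ar (Delta J W X) (\<beta>, \<nu>, \<gamma>) =
    (ob (Delta J W X) \<beta>, \<lambda>j \<in> Obj J. \<lambda>w \<in> Obj (at_ob W j). \<nu> j undefined, ob (Delta J W X) \<gamma>)"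
  using assms
  by (auto simp: Delta_def precomp_functor_def diag_hom_def to_terminal_def modification_def
      const_functor_def fun_eq_iff)

text \<open>\<open>Delta\<close> of \<open>\<beta>\<close> is constant at each level, so naturality
  there is the cocone condition. In this form the levelwise universal properties of colimits
  apply.\<close>

lemma modification_Delta:
  assumes \<alpha>: "diag_trans J W X \<alpha>" and \<beta>: "diag_trans J terminal_diag X \<beta>"
  shows "modification J W X \<alpha> (ob (Delta J W X) \<beta>) \<mu> \<longleftrightarrow>
    \<mu> \<in> extensional (Obj J) \<and>
    (\<forall>j \<in> Obj J. cocone (at_ob W j) (at_ob X j) (\<alpha> j) (ob (\<beta> j) undefined) (\<mu> j)) \<and>
    (\<forall>f \<in> Arr J. \<forall>w \<in> Obj (at_ob W (Dom J f)).
      ar (at_ar X f) (\<mu> (Dom J f) w) = \<mu> (Cod J f) (ob (at_ar W f) w))"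
proof -
  have "diagram J W" "diagram J X" using \<alpha> by (auto simp: diag_trans_def)
  then have "ob (Delta J W X) \<beta> \<in> Obj (diag_hom J W X)"
    using cat_functor.ob_in[OF cat_functor_Delta, of J W X \<beta>] \<beta> by (simp add: diag_hom_def)
  then have "diag_trans J W X (ob (Delta J W X) \<beta>)" by (simp add: diag_hom_def)
  then show ?thesis
    using \<alpha> terminal_coneD(1)[OF \<beta>] by (auto simp: modification_def ob_Delta[OF \<beta>] cocone_def)
qed

text \<open>Factorisations exist uniquely at each level; what remains is their compatibility with
  the transition functors. This can be tested only on legs indexed by the image of
  \<open>W_f\<close>, whence the form of \<open>jointly_epi\<close>.\<close>

lemma universal_arrow_to_Delta:
  fixes W :: "('j, 'k, 'o, 'm) diag" and X :: "('j, 'k, 'p, 'n) diag"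
  assumes \<alpha>: "diag_trans J W X \<alpha>"
    and colim: "\<And>j. j \<in> Obj J \<Longrightarrow> is_colimit (at_ob W j) (at_ob X j) (\<alpha> j) (d j) (\<iota> j)"
    and jointly_epi: "\<And>f h h' e. \<lbrakk>f \<in> Arr J; h \<in> hom (at_ob X (Cod J f)) (d (Cod J f)) e;
        h' \<in> hom (at_ob X (Cod J f)) (d (Cod J f)) e;
        \<And>w. w \<in> Obj (at_ob W (Dom J f)) \<Longrightarrow>
          Comp (at_ob X (Cod J f)) h (\<iota> (Cod J f) (ob (at_ar W f) w)) =
          Comp (at_ob X (Cod J f)) h' (\<iota> (Cod J f) (ob (at_ar W f) w))\<rbrakk> \<Longrightarrow> h = h'"
    and d_nat: "\<And>f. f \<in> Arr J \<Longrightarrow> ob (at_ar X f) (d (Dom J f)) = d (Cod J f)"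
    and \<iota>_nat: "\<And>f w. f \<in> Arr J \<Longrightarrow> w \<in> Obj (at_ob W (Dom J f)) \<Longrightarrow>
      ar (at_ar X f) (\<iota> (Dom J f) w) = \<iota> (Cod J f) (ob (at_ar W f) w)"
  shows "\<exists>\<beta> \<eta>. \<beta> \<in> Obj (diag_hom J terminal_diag X) \<and>
      \<eta> \<in> hom (diag_hom J W X) \<alpha> (ob (Delta J W X) \<beta>) \<and>
      (\<forall>\<gamma> \<in> Obj (diag_hom J terminal_diag X). \<forall>g \<in> hom (diag_hom J W X) \<alpha> (ob (Delta J W X) \<gamma>).
        \<exists>!h. h \<in> hom (diag_hom J terminal_diag X) \<beta> \<gamma> \<and>
          Comp (diag_hom J W X) (ar (Delta J W X) h) \<eta> = g)"
proof -
  interpret W: diagram J W using \<alpha> by (simp add: diag_trans_def)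
  interpret X: diagram J X using \<alpha> by (simp add: diag_trans_def)
  have dc: "Dom J f \<in> Obj J" "Cod J f \<in> Obj J" if "f \<in> Arr J" for f
    using that W.J.Dom_in W.J.Cod_in by auto
  note io = coconeD[OF colimit_cocone[OF colim]]
  define \<beta> :: "'j \<Rightarrow> ('o, 'm, 'p, 'n) fctr" where
    "\<beta> = (\<lambda>j \<in> Obj J. const_functor terminal_category (at_ob X j) (d j))"
  define \<eta> where "\<eta> = (\<lambda>j \<in> Obj J. \<iota> j)"
  have \<beta>: "diag_trans J terminal_diag X \<beta>"
    unfolding \<beta>_def by (rule diag_trans_strict_cone[OF X.diagram_axioms io(2) d_nat])
  have \<beta>_ob: "ob (\<beta> j) undefined = d j" if "j \<in> Obj J" for j
    using that by (simp add: \<beta>_def const_functor_def terminal_simps)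
  have \<eta>: "modification J W X \<alpha> (ob (Delta J W X) \<beta>) \<eta>"
    unfolding modification_Delta[OF \<alpha> \<beta>]
    using colimit_cocone[OF colim] \<iota>_nat dc by (simp add: \<beta>_ob \<eta>_def)
  have comp: "Comp (diag_hom J W X) (ar (Delta J W X) (\<beta>, \<nu>, \<gamma>)) (\<alpha>, \<eta>, ob (Delta J W X) \<beta>) =
      (\<alpha>, \<lambda>j \<in> Obj J. \<lambda>w \<in> Obj (at_ob W j). Comp (at_ob X j) (\<nu> j undefined) (\<iota> j w),
        ob (Delta J W X) \<gamma>)" if "modification J terminal_diag X \<beta> \<gamma> \<nu>" for \<gamma> \<nu>
    unfolding ar_Delta[OF that] by (simp add: diag_hom_def \<eta>_def fun_eq_iff)
  have "\<exists>!h. h \<in> hom (diag_hom J terminal_diag X) \<beta> \<gamma> \<and>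
      Comp (diag_hom J W X) (ar (Delta J W X) h) (\<alpha>, \<eta>, ob (Delta J W X) \<beta>) = g"
    if \<gamma>_Obj: "\<gamma> \<in> Obj (diag_hom J terminal_diag X)" and g_hom: "g \<in> hom (diag_hom J W X) \<alpha> (ob (Delta J W X) \<gamma>)" for \<gamma> g
  proof -
    have \<gamma>: "diag_trans J terminal_diag X \<gamma>" using \<gamma>_Obj by (simp add: diag_hom_def)
    obtain \<mu> where g: "g = (\<alpha>, \<mu>, ob (Delta J W X) \<gamma>)"
      and "modification J W X \<alpha> (ob (Delta J W X) \<gamma>) \<mu>"
      using g_hom by (auto simp: diag_hom_def hom_def)
    then have \<mu>_ext: "\<mu> \<in> extensional (Obj J)"
      and \<mu>: "\<And>j. j \<in> Obj J \<Longrightarrow> cocone (at_ob W j) (at_ob X j) (\<alpha> j) (ob (\<gamma> j) undefined) (\<mu> j)"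
      and \<mu>_nat: "\<And>f w. f \<in> Arr J \<Longrightarrow> w \<in> Obj (at_ob W (Dom J f)) \<Longrightarrow>
        ar (at_ar X f) (\<mu> (Dom J f) w) = \<mu> (Cod J f) (ob (at_ar W f) w)"
      unfolding modification_Delta[OF \<alpha> \<gamma>] by auto
    have "\<exists>h. h \<in> hom (at_ob X j) (d j) (ob (\<gamma> j) undefined) \<and>
        (\<forall>w \<in> Obj (at_ob W j). Comp (at_ob X j) h (\<iota> j w) = \<mu> j w)" if "j \<in> Obj J" for j
      using colimit_factor[OF colim[OF that] \<mu>[OF that]] by metis
    then obtain h where h: "\<And>j. j \<in> Obj J \<Longrightarrow> h j \<in> hom (at_ob X j) (d j) (ob (\<gamma> j) undefined)"
      and h_fac: "\<And>j w. j \<in> Obj J \<Longrightarrow> w \<in> Obj (at_ob W j) \<Longrightarrow> Comp (at_ob X j) (h j) (\<iota> j w) = \<mu> j w"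
      by metis
    define \<nu> :: "'j \<Rightarrow> 'o \<Rightarrow> 'n" where "\<nu> = (\<lambda>j \<in> Obj J. \<lambda>x \<in> {undefined}. h j)"
    \<comment> \<open>On the leg at \<open>W_f w\<close> both sides give
      \<open>\<mu> (Cod J f)\<close> at \<open>W_f w\<close>. For the left side,
      \<open>\<iota>_nat\<close> writes the leg as an image under \<open>X_f\<close>, functoriality
      and \<open>h_fac\<close> produce the image of \<open>\<mu>\<close>, and
      \<open>\<mu>_nat\<close> finishes.\<close>
    have h_nat: "ar (at_ar X f) (h (Dom J f)) = h (Cod J f)" if f: "f \<in> Arr J" for f
    proof (rule jointly_epi[OF f])
      interpret F: cat_functor "at_ob X (Dom J f)" "at_ob X (Cod J f)" "at_ar X f"
        by (rule X.at_ar_functor[OF f])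
      have "comp_functor terminal_category (at_ar X f) (\<gamma> (Dom J f)) =
          comp_functor terminal_category (\<gamma> (Cod J f)) (id_functor terminal_category)"
        using \<gamma> f by (simp add: diag_trans_def terminal_simps)
      from arg_cong[OF this, of "\<lambda>F. ob F undefined"]
      have \<gamma>_nat: "ob (at_ar X f) (ob (\<gamma> (Dom J f)) undefined) = ob (\<gamma> (Cod J f)) undefined"
        by (simp add: terminal_simps id_functor_def)
      show "ar (at_ar X f) (h (Dom J f)) \<in>
          hom (at_ob X (Cod J f)) (d (Cod J f)) (ob (\<gamma> (Cod J f)) undefined)"
        using F.ar_hom[OF h[OF dc(1)[OF f]]] by (simp add: d_nat[OF f] \<gamma>_nat)
      show "h (Cod J f) \<in> hom (at_ob X (Cod J f)) (d (Cod J f)) (ob (\<gamma> (Cod J f)) undefined)"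
        by (rule h[OF dc(2)[OF f]])
      fix w assume w: "w \<in> Obj (at_ob W (Dom J f))"
      have "ob (at_ar W f) w \<in> Obj (at_ob W (Cod J f))"
        by (rule cat_functor.ob_in[OF W.at_ar_functor[OF f] w])
      then show "Comp (at_ob X (Cod J f)) (ar (at_ar X f) (h (Dom J f))) (\<iota> (Cod J f) (ob (at_ar W f) w)) =
          Comp (at_ob X (Cod J f)) (h (Cod J f)) (\<iota> (Cod J f) (ob (at_ar W f) w))"
        using F.ar_comp[OF io(4)[OF dc(1)[OF f] w] h[OF dc(1)[OF f]]] h_fac[OF dc(1)[OF f] w]
          h_fac[OF dc(2)[OF f]] \<mu>_nat[OF f w] \<iota>_nat[OF f w] by simp
    qed
    have \<nu>: "modification J terminal_diag X \<beta> \<gamma> \<nu>"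
      unfolding modification_terminal[OF \<beta> \<gamma>] using h h_nat dc by (simp add: \<nu>_def \<beta>_ob)
    show ?thesis
    proof (rule ex1I[of _ "(\<beta>, \<nu>, \<gamma>)"])
      have "(\<lambda>j \<in> Obj J. \<lambda>w \<in> Obj (at_ob W j). Comp (at_ob X j) (\<nu> j undefined) (\<iota> j w)) = \<mu>"
      proof (rule extensionalityI[OF restrict_extensional \<mu>_ext])
        fix j assume j: "j \<in> Obj J"
        have "(\<lambda>w \<in> Obj (at_ob W j). Comp (at_ob X j) (h j) (\<iota> j w)) = \<mu> j"
          by (rule extensionalityI[OF restrict_extensional coconeD(3)[OF \<mu>[OF j]]]) (simp add: h_fac j)
        then show "(\<lambda>j \<in> Obj J. \<lambda>w \<in> Obj (at_ob W j). Comp (at_ob X j) (\<nu> j undefined) (\<iota> j w)) j = \<mu> j"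
          using j by (simp add: \<nu>_def)
      qed
      then show "(\<beta>, \<nu>, \<gamma>) \<in> hom (diag_hom J terminal_diag X) \<beta> \<gamma> \<and>
          Comp (diag_hom J W X) (ar (Delta J W X) (\<beta>, \<nu>, \<gamma>)) (\<alpha>, \<eta>, ob (Delta J W X) \<beta>) = g"
        unfolding comp[OF \<nu>] g using \<nu> by (simp add: diag_hom_def hom_def)
    next
      fix k assume k: "k \<in> hom (diag_hom J terminal_diag X) \<beta> \<gamma> \<and>
          Comp (diag_hom J W X) (ar (Delta J W X) k) (\<alpha>, \<eta>, ob (Delta J W X) \<beta>) = g"
      then obtain \<nu>' where k': "k = (\<beta>, \<nu>', \<gamma>)" and \<nu>': "modification J terminal_diag X \<beta> \<gamma> \<nu>'"
        by (auto simp: diag_hom_def hom_def)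
      have \<mu>_eq: "(\<lambda>j \<in> Obj J. \<lambda>w \<in> Obj (at_ob W j). Comp (at_ob X j) (\<nu>' j undefined) (\<iota> j w)) = \<mu>"
        using k unfolding k' comp[OF \<nu>'] g by simp
      note \<nu>'D = \<nu>'[unfolded modification_terminal[OF \<beta> \<gamma>]]
      have "\<nu>' = \<nu>"
      proof (rule extensionalityI[of _ "Obj J"])
        fix j assume j: "j \<in> Obj J"
        \<comment> \<open>A competing modification factors the same cocone at each level, so its
          component there is forced.\<close>
        have "\<nu>' j undefined = h j"
        proof (rule colimit_hom_eqI[OF colim[OF j] _ h[OF j]])
          show "\<nu>' j undefined \<in> hom (at_ob X j) (d j) (ob (\<gamma> j) undefined)"
            using \<nu>'D j by (simp add: \<beta>_ob)
          show "Comp (at_ob X j) (\<nu>' j undefined) (\<iota> j w) = Comp (at_ob X j) (h j) (\<iota> j w)"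
            if "w \<in> Obj (at_ob W j)" for w
            using fun_cong[OF fun_cong[OF \<mu>_eq], of j w] that j by (simp add: h_fac)
        qed
        moreover have "\<nu>' j \<in> extensional {undefined}" using \<nu>'D j by simp
        ultimately show "\<nu>' j = \<nu> j"
          using j by (intro extensionalityI[of _ "{undefined}"]) (auto simp: \<nu>_def)
      qed (use \<nu>'D in \<open>simp_all add: \<nu>_def\<close>)
      then show "k = (\<beta>, \<nu>, \<gamma>)" by (simp add: k')
    qed
  qed
  moreover have "(\<alpha>, \<eta>, ob (Delta J W X) \<beta>) \<in> hom (diag_hom J W X) \<alpha> (ob (Delta J W X) \<beta>)"
    using \<eta> by (simp add: diag_hom_def hom_def)
  moreover have "\<beta> \<in> Obj (diag_hom J terminal_diag X)" using \<beta> by (simp add: diag_hom_def)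
  ultimately show ?thesis by blast
qed

theorem theoremA1:
  fixes J :: "('u, 'u) cat"
    and W X :: "('u, 'u, 'u, 'u) diag"
  assumes universe: "infinite (UNIV :: 'u set)"
    and J: "category J"
    and W: "diagram J W" and W_small: "\<And>j. j \<in> Obj J \<Longrightarrow> small_category (at_ob W j)"
    and X: "diagram J X"
    and fibrant: "injective_fibrant J X"
    and colims: "\<And>f j k. f \<in> hom J j k \<Longrightarrow>
          admits_colimits (at_ob W j) (at_ob X k) \<and> admits_colimits (at_ob W k) (at_ob X k)"
    and preserves: "\<And>f j k. f \<in> hom J j k \<Longrightarrow>
          preserves_colimits (at_ob W j) (at_ob X j) (at_ob X k) (at_ar X f)"
    and final: "\<And>f j k. f \<in> hom J j k \<Longrightarrow>
          final_functor (at_ob W j) (at_ob W k) (at_ar W f)"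
  shows "admits_left_adjoint (diag_hom J terminal_diag X) (diag_hom J W X) (Delta J W X)"
proof (rule admits_left_adjoint_if_universal_arrows[OF cat_functor_Delta[OF W X]])
  interpret J: category J by (rule J)
  \<comment> \<open>Hypothesis (i) at the identity arrow of \<open>j\<close> gives
    \<open>W_j\<close>-colimits in \<open>X_j\<close>.\<close>
  have colims': "admits_colimits (at_ob W j) (at_ob X j)" if "j \<in> Obj J" for j
    using colims[OF J.Ide_in[OF that]] by blast
  fix \<alpha> assume "\<alpha> \<in> Obj (diag_hom J W X)"
  then have \<alpha>: "diag_trans J W X \<alpha>" by (simp add: diag_hom_def)
  obtain d \<iota> where colim: "\<And>j. j \<in> Obj J \<Longrightarrow> is_colimit (at_ob W j) (at_ob X j) (\<alpha> j) (d j) (\<iota> j)"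
    and d_nat: "\<And>f. f \<in> Arr J \<Longrightarrow> ob (at_ar X f) (d (Dom J f)) = d (Cod J f)"
    and \<iota>_nat: "\<And>f w. f \<in> Arr J \<Longrightarrow> w \<in> Obj (at_ob W (Dom J f)) \<Longrightarrow>
      ar (at_ar X f) (\<iota> (Dom J f) w) = \<iota> (Cod J f) (ob (at_ar W f) w)"
    using strict_colimit_cone[OF universe fibrant colims' preserves final \<alpha>] by blast
  show "\<exists>\<beta> \<eta>. \<beta> \<in> Obj (diag_hom J terminal_diag X) \<and>
      \<eta> \<in> hom (diag_hom J W X) \<alpha> (ob (Delta J W X) \<beta>) \<and>
      (\<forall>\<gamma> \<in> Obj (diag_hom J terminal_diag X). \<forall>g \<in> hom (diag_hom J W X) \<alpha> (ob (Delta J W X) \<gamma>).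
        \<exists>!h. h \<in> hom (diag_hom J terminal_diag X) \<beta> \<gamma> \<and>
          Comp (diag_hom J W X) (ar (Delta J W X) h) \<eta> = g)"
  proof (rule universal_arrow_to_Delta[OF \<alpha> colim _ d_nat \<iota>_nat])
    fix f h h' e assume f: "f \<in> Arr J"
      and h: "h \<in> hom (at_ob X (Cod J f)) (d (Cod J f)) e" "h' \<in> hom (at_ob X (Cod J f)) (d (Cod J f)) e"
      and eq: "\<And>w. w \<in> Obj (at_ob W (Dom J f)) \<Longrightarrow>
          Comp (at_ob X (Cod J f)) h (\<iota> (Cod J f) (ob (at_ar W f) w)) =
          Comp (at_ob X (Cod J f)) h' (\<iota> (Cod J f) (ob (at_ar W f) w))"
    \<comment> \<open>By finality the colimit cocone stays universal after restriction along
      \<open>W_f\<close>, so the legs indexed by the image of \<open>W_f\<close> are already jointly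
      epic.\<close>
    show "h = h'"
      by (rule colimit_hom_eqI[OF colimit_final[OF final[OF Arr_hom[OF f]] colim[OF J.Cod_in[OF f]]] h])
        (simp add: eq)
  qed
qed

end
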